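(* Let $\Sigma$ be a fan in $N_{\mathbb{R}}$ and $P$ an arbitrary point of $X_\Sigma^{\mathrm{cong}}$. Then there is at most one point $P_0$ of $X_\Sigma^{\mathrm{trop}}$ (regarded as a subspace of $X_\Sigma^{\mathrm{cong}}$) contained in the closure $\overline{\{P\}}$ of $\{P\}$ in $X_\Sigma^{\mathrm{cong}}$.
   Context: $\mathbb{T}=\mathbb{R}\cup\{-\infty\}$ is the semifield with $\oplus=\max$, $\odot=+$. A congruence on a commutative semiring $S$ is a subsemiring $C\subseteq S\times S$ which is an equivalence relation. It is prime if $(S\times S)\setminus C$ is nonempty and closed under $(a,b)\rtimes(c,d)=(ac+bd,ad+bc)$. $\operatorname{CSpec}S$ is the set of prime congruences with the topology whose closed sets are $V(C)=\{P\mid C\subseteq P\}$, $C$ a congruence. For a semiring $S$ with a fixed injective homomorphism $\mathbb{T}\to S$, $\operatorname{CSpec}_{\mathbb{T}}S\subseteq\operatorname{CSpec}S$ (subspace topology) is the set of prime congruences $P$ such that $\mathbb{T}\to S\to S/P$ is injective. $M,N$ are dual free abelian groups of rank $n$ with pairing $\langle\cdot,\cdot\rangle:M\times N\to\mathbb{Z}$; $M_{\mathbb R}=M\otimes\mathbb{R}$, $N_{\mathbb R}=N\otimes\mathbb{R}$. A cone is the set of nonnegative real combinations of a finite subset of $N$; it is strongly convex if $\sigma\cap-\sigma=\{0\}$. A fan $\Sigma$ is a (finite, nonempty) polyhedral complex in $N_{\mathbb{R}}$ consisting of strongly convex cones. For a cone $\sigma$, $\sigma^\vee=\{m\in M_{\mathbb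 R}\mid\langle m,v\rangle\ge0\ \forall v\in\sigma\}$ and $\mathsf{M}_\sigma=\sigma^\vee\cap M$. $\mathbb{T}[\mathsf{M}_\sigma]$ is the monoid semiring of $\mathsf{M}_\sigma$ over $\mathbb{T}$ (finite formal $\mathbb{T}$-linear combinations of elements of $\mathsf{M}_\sigma$), a $\mathbb{T}$-algebra via constants. Set $U_\sigma^{\mathrm{cong}}=\operatorname{CSpec}_{\mathbb{T}}\mathbb{T}[\mathsf{M}_\sigma]$. For a face $\tau$ of $\sigma$, pulling back congruences along $\mathbb{T}[\mathsf{M}_\sigma]\hookrightarrow\mathbb{T}[\mathsf{M}_\tau]$ gives an open embedding $U_\tau^{\mathrm{cong}}\hookrightarrow U_\sigma^{\mathrm{cong}}$; $X_\Sigma^{\mathrm{cong}}$ is the topological space obtained by gluing the $U_\sigma^{\mathrm{cong}}$, $\sigma\in\Sigma$, along these maps. Set $U_\sigma^{\mathrm{trop}}=\operatorname{Hom}(\mathsf{M}_\sigma,\mathbb{T})$, the monoid homomorphisms $(\mathsf{M}_\sigma,+)\to(\mathbb{T},\odot)$; $X_\Sigma^{\mathrm{trop}}$ is obtained by gluing the $U_\sigma^{\mathrm{trop}}$ along the restriction maps $U_\tau^{\mathrm{trop}}\hookrightarrow U_\sigma^{\mathrm{trop}}$ for faces $\tau$ of $\sigma$. It is regarded as a subspace of $X_\Sigma^{\mathrm{cong}}$ via the injection glued from the maps $U_\sigma^{\mathrm{trop}}\to U_\sigma^{\mathrm{cong}}$ sending $\phi$ to the kernel congruence of the induced homomorphism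 $\mathbb{T}[\mathsf{M}_\sigma]\to\mathbb{T}$, $rm\mapsto r\odot\phi(m)$. (Equivalently, its points in the chart $U_\sigma^{\mathrm{cong}}$ are the geometric congruences, i.e. the $P$ for which $\mathbb{T}\to\mathbb{T}[\mathsf{M}_\sigma]\to\mathbb{T}[\mathsf{M}_\sigma]/P$ is an isomorphism.) *)

theory Defs
  imports "HOL-Analysis.Analysis" "HOL-Library.Poly_Mapping" "HOL-Library.FuncSet"
begin

datatype trop = NegInf | Fin real

instantiation trop :: comm_semiring_1
begin

definition zero_trop :: trop where "0 = NegInf"

definition one_trop :: trop where "1 = Fin 0"

fun plus_trop :: "trop \<Rightarrow> trop \<Rightarrow> trop" where
  "NegInf + b = b"
| "Fin a + NegInf = Fin a"
| "Fin a + Fin b = Fin (max a b)"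

fun times_trop :: "trop \<Rightarrow> trop \<Rightarrow> trop" where
  "NegInf * b = NegInf"
| "Fin a * NegInf = NegInf"
| "Fin a * Fin b = Fin (a + b)"

instance
proof
  fix a b c :: trop
  show "a + b + c = a + (b + c)" by (cases a; cases b; cases c) simp_all
  show "a + b = b + a" by (cases a; cases b) simp_all
  show "0 + a = a" by (simp add: zero_trop_def)
  show "a * b * c = a * (b * c)" by (cases a; cases b; cases c) simp_all
  show "a * b = b * a" by (cases a; cases b) simp_all
  show "1 * a = a" by (cases a) (simp_all add: one_trop_def)
  show "(a + b) * c = a * c + b * c" by (cases a; cases b; cases c) simp_all
  show "0 * a = 0" by (simp add: zero_trop_def)
  show "a * 0 = 0" by (cases a) (simp_all add: zero_trop_def)
  show "(0 :: trop) \<noteq> 1" by (simp add: zero_trop_def one_trop_def)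
qed

end

text \<open>A semiring is given as a subsemiring \<open>S\<close> of a commutative semiring type. A congruence
  contains \<open>(0, 0)\<close> and \<open>(1, 1)\<close> by reflexivity, so being a subsemiring of
  \<open>S \<times> S\<close> only requires closure under both operations.\<close>

definition subsemiring :: "'a::comm_semiring_1 set \<Rightarrow> bool" where
  "subsemiring S \<longleftrightarrow> 0 \<in> S \<and> 1 \<in> S \<and> (\<forall>a\<in>S. \<forall>b\<in>S. a + b \<in> S \<and> a * b \<in> S)"

definition congruence :: "'a::comm_semiring_1 set \<Rightarrow> ('a \<times> 'a) set \<Rightarrow> bool" where
  "congruence S C \<longleftrightarrow> C \<subseteq> S \<times> S \<and> equiv S C \<and>
     (\<forall>a b c d. (a, b) \<in> C \<longrightarrow> (c, d) \<in> C \<longrightarrow> (a + c, b + d) \<in> C \<and> (a * c, b * d) \<in> C)"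

fun twisted_prod :: "'a::comm_semiring_1 \<times> 'a \<Rightarrow> 'a \<times> 'a \<Rightarrow> 'a \<times> 'a" where
  "twisted_prod (a, b) (c, d) = (a * c + b * d, a * d + b * c)"

definition prime_congruence :: "'a::comm_semiring_1 set \<Rightarrow> ('a \<times> 'a) set \<Rightarrow> bool" where
  "prime_congruence S P \<longleftrightarrow> congruence S P \<and> S \<times> S - P \<noteq> {} \<and>
     (\<forall>x \<in> S \<times> S - P. \<forall>y \<in> S \<times> S - P. twisted_prod x y \<in> S \<times> S - P)"

definition Vset :: "'a::comm_semiring_1 set \<Rightarrow> ('a \<times> 'a) set \<Rightarrow> ('a \<times> 'a) set set" where
  "Vset S C = {P. prime_congruence S P \<and> C \<subseteq> P}"

definition CSpec :: "'a::comm_semiring_1 set \<Rightarrow> ('a \<times> 'a) set topology" where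
  "CSpec S = topology (\<lambda>U. \<exists>C. congruence S C \<and> U = {P. prime_congruence S P} - Vset S C)"

text \<open>\<open>c\<close> is the structure map from \<open>\<T>\<close> to \<open>S\<close>; its composite with the
  quotient map sends \<open>a\<close> to the class \<open>P `` {c a}\<close>.\<close>

definition CSpec_T :: "(trop \<Rightarrow> 'a) \<Rightarrow> 'a::comm_semiring_1 set \<Rightarrow> ('a \<times> 'a) set topology" where
  "CSpec_T c S = subtopology (CSpec S) {P. inj (\<lambda>a. P `` {c a})}"

lemma congruence_add:
  "congruence S C \<Longrightarrow> (a, b) \<in> C \<Longrightarrow> (c, d) \<in> C \<Longrightarrow> (a + c, b + d) \<in> C"
  by (simp add: congruence_def)

lemma congruence_mult:
  "congruence S C \<Longrightarrow> (a, b) \<in> C \<Longrightarrow> (c, d) \<in> C \<Longrightarrow> (a * c, b * d) \<in> C"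
  by (simp add: congruence_def)

lemma congruence_Inter:
  assumes "\<And>C. C \<in> K \<Longrightarrow> congruence S C" and "K \<noteq> {}"
  shows "congruence S (\<Inter>K)"
proof -
  from assms(2) obtain C0 where C0: "C0 \<in> K" by blast
  have "\<Inter>K \<subseteq> S \<times> S" using assms(1)[OF C0] C0 by (auto simp: congruence_def)
  moreover have "equiv S (\<Inter>K)"
    unfolding equiv_def
  proof (intro conjI)
    show "\<Inter>K \<subseteq> S \<times> S" by fact
    show "refl_on S (\<Inter>K)"
      using assms(1) by (auto simp: congruence_def equiv_def refl_on_def)
    show "sym (\<Inter>K)"
      using assms(1) by (auto simp: congruence_def equiv_def sym_def)
    show "trans (\<Inter>K)"
      unfolding trans_def
    proof (intro allI impI InterI)
      fix x y z C assume "(x, y) \<in> \<Inter>K" "(y, z) \<in> \<Inter>K" "C \<in> K"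
      then show "(x, z) \<in> C"
        using assms(1)[of C] by (auto simp: congruence_def equiv_def dest: transD)
    qed
  qed
  moreover have "\<forall>a b c d. (a, b) \<in> \<Inter>K \<longrightarrow> (c, d) \<in> \<Inter>K \<longrightarrow>
      (a + c, b + d) \<in> \<Inter>K \<and> (a * c, b * d) \<in> \<Inter>K"
    using assms(1) by (simp add: congruence_def)
  ultimately show ?thesis unfolding congruence_def by blast
qed

lemma congruence_Int:
  assumes "congruence S C" "congruence S D"
  shows "congruence S (C \<inter> D)"
  using congruence_Inter[of "{C, D}" S] assms by auto

lemma Vset_Int:
  assumes C: "congruence S C" and D: "congruence S D"
  shows "Vset S (C \<inter> D) = Vset S C \<union> Vset S D"
proof
  show "Vset S C \<union> Vset S D \<subseteq> Vset S (C \<inter> D)" by (auto simp: Vset_def)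
  show "Vset S (C \<inter> D) \<subseteq> Vset S C \<union> Vset S D"
  proof
    fix P assume "P \<in> Vset S (C \<inter> D)"
    then have P: "prime_congruence S P" and sub: "C \<inter> D \<subseteq> P" by (auto simp: Vset_def)
    show "P \<in> Vset S C \<union> Vset S D"
    proof (rule ccontr)
      assume "P \<notin> Vset S C \<union> Vset S D"
      with P obtain a b c d where
        ab: "(a, b) \<in> C" "(a, b) \<notin> P" and cd: "(c, d) \<in> D" "(c, d) \<notin> P"
        by (auto simp: Vset_def)
      have S: "a \<in> S" "b \<in> S" "c \<in> S" "d \<in> S"
        using ab cd C D by (auto simp: congruence_def)
      have ba: "(b, a) \<in> C" and dc: "(d, c) \<in> D"
        using ab cd C D by (auto simp: congruence_def equiv_def sym_def)
      have rC: "(c, c) \<in> C" "(d, d) \<in> C" and rD: "(a, a) \<in> D" "(b, b) \<in> D"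
        using S C D by (auto simp: congruence_def equiv_def refl_on_def)
      have "(a * c + b * d, b * c + a * d) \<in> C"
        using ab(1) ba rC by (intro congruence_add[OF C] congruence_mult[OF C])
      moreover have "(a * c + b * d, a * d + b * c) \<in> D"
        using cd(1) dc rD by (intro congruence_add[OF D] congruence_mult[OF D])
      ultimately have "twisted_prod (a, b) (c, d) \<in> P"
        using sub by (auto simp: add.commute)
      moreover have "twisted_prod (a, b) (c, d) \<in> S \<times> S - P"
        using P S ab(2) cd(2) by (simp add: prime_congruence_def del: twisted_prod.simps)
      ultimately show False by blast
    qed
  qed
qed

lemma istopology_CSpec:
  assumes "subsemiring S"
  shows "istopology (\<lambda>U. \<exists>C. congruence S C \<and> U = {P. prime_congruence S P} - Vset S C)"
    (is "istopology ?T")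
  unfolding istopology_def
proof (intro conjI allI impI)
  fix U W assume "?T U" "?T W"
  then obtain C D where "congruence S C" "U = {P. prime_congruence S P} - Vset S C"
    and "congruence S D" "W = {P. prime_congruence S P} - Vset S D" by blast
  then show "?T (U \<inter> W)"
    using Vset_Int[of S C D] congruence_Int[of S C D] by (intro exI[of _ "C \<inter> D"]) blast
next
  fix K assume K: "\<forall>U\<in>K. ?T U"
  let ?Ds = "{C. congruence S C \<and> {P. prime_congruence S P} - Vset S C \<in> K}"
  let ?L = "{E. congruence S E \<and> (\<forall>C\<in>?Ds. C \<subseteq> E)}"
  have "congruence S (S \<times> S)"
    using assms
    by (auto simp: congruence_def subsemiring_def equiv_def refl_on_def sym_def trans_def)
  then have "S \<times> S \<in> ?L" by (auto simp: congruence_def)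
  then have cong: "congruence S (\<Inter>?L)"
    by (intro congruence_Inter) (blast, rule ex_in_conv[THEN iffD1], rule exI)
  have iff: "\<Inter>?L \<subseteq> P \<longleftrightarrow> (\<forall>C\<in>?Ds. C \<subseteq> P)" if "prime_congruence S P" for P
  proof
    assume L: "\<Inter>?L \<subseteq> P"
    show "\<forall>C\<in>?Ds. C \<subseteq> P"
    proof
      fix C assume "C \<in> ?Ds"
      then have "C \<subseteq> \<Inter>?L" by (intro Inter_greatest) simp
      with L show "C \<subseteq> P" by (rule order_trans[rotated])
    qed
  next
    assume "\<forall>C\<in>?Ds. C \<subseteq> P"
    then have "P \<in> ?L" using that by (simp add: prime_congruence_def)
    then show "\<Inter>?L \<subseteq> P" by (rule Inter_lower)
  qed
  have "\<Union>K = {P. prime_congruence S P} - Vset S (\<Inter>?L)"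
  proof (intro set_eqI iffI)
    fix P assume "P \<in> \<Union>K"
    then obtain U where "U \<in> K" "P \<in> U" by blast
    with K obtain C where C: "congruence S C" "U = {P. prime_congruence S P} - Vset S C" by blast
    with \<open>U \<in> K\<close> have "C \<in> ?Ds" by simp
    moreover have "prime_congruence S P" "\<not> C \<subseteq> P"
      using C(2) \<open>P \<in> U\<close> by (simp_all add: Vset_def)
    ultimately
    show "P \<in> {P. prime_congruence S P} - Vset S (\<Inter>?L)"
      using iff[of P] unfolding Vset_def by blast
  next
    fix P assume "P \<in> {P. prime_congruence S P} - Vset S (\<Inter>?L)"
    then have P: "prime_congruence S P" and "\<not> \<Inter>?L \<subseteq> P" by (auto simp: Vset_def)
    with iff[OF P] obtain C where "C \<in> ?Ds" "\<not> C \<subseteq> P" by blast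
    then have "P \<in> {P. prime_congruence S P} - Vset S C" and "{P. prime_congruence S P} - Vset S C \<in> K"
      using P by (simp_all add: Vset_def)
    then show "P \<in> \<Union>K" by blast
  qed
  with cong show "?T (\<Union>K)" by blast
qed

lemma openin_CSpec:
  assumes "subsemiring S"
  shows "openin (CSpec S) U \<longleftrightarrow>
    (\<exists>C. congruence S C \<and> U = {P. prime_congruence S P} - Vset S C)"
  unfolding CSpec_def by (simp only: topology_inverse'[OF istopology_CSpec[OF assms]])

lemma topspace_CSpec:
  assumes "subsemiring S"
  shows "topspace (CSpec S) = {P. prime_congruence S P}"
proof
  show "topspace (CSpec S) \<subseteq> {P. prime_congruence S P}"
    using openin_topspace[of "CSpec S"] unfolding openin_CSpec[OF assms] by blast
  have "congruence S (S \<times> S)"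
    using assms
    by (auto simp: congruence_def subsemiring_def equiv_def refl_on_def sym_def trans_def)
  moreover have "Vset S (S \<times> S) = {}"
    by (auto simp: Vset_def prime_congruence_def congruence_def)
  ultimately have "openin (CSpec S) {P. prime_congruence S P}"
    unfolding openin_CSpec[OF assms] by (intro exI[of _ "S \<times> S"]) auto
  then show "{P. prime_congruence S P} \<subseteq> topspace (CSpec S)"
    by (rule openin_subset)
qed

text \<open>\<open>M\<close> and \<open>N\<close> are the integral spans of mutually dual bases. Duality forces
  these bases to be linearly independent over the reals, so the tensor products of
  \<open>M\<close> and \<open>N\<close> with the reals are the subspaces \<open>span M\<close> and \<open>span N\<close>; the
  pairing is the bilinear extension of the integral one. Using subspaces rather than whole
  types allows every rank, including \<open>0\<close>.\<close>

definition dual_lattices ::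
  "nat \<Rightarrow> 'm::real_vector set \<Rightarrow> 'n::real_vector set \<Rightarrow> ('m \<Rightarrow> 'n \<Rightarrow> real) \<Rightarrow> bool" where
  "dual_lattices n M N pairing \<longleftrightarrow> bilinear pairing \<and>
     (\<exists>e f. (\<forall>i<n. \<forall>j<n. pairing (e i) (f j) = (if i = j then 1 else 0)) \<and>
        M = {\<Sum>i<n. of_int (k i) *\<^sub>R e i | k :: nat \<Rightarrow> int. True} \<and>
        N = {\<Sum>i<n. of_int (k i) *\<^sub>R f i | k :: nat \<Rightarrow> int. True})"

definition cone_in :: "'n::real_vector set \<Rightarrow> 'n set \<Rightarrow> bool" where
  "cone_in N \<sigma> \<longleftrightarrow> (\<exists>F. finite F \<and> F \<subseteq> N \<and>
     \<sigma> = {\<Sum>v\<in>F. c v *\<^sub>R v | c :: 'n \<Rightarrow> real. \<forall>v\<in>F. 0 \<le> c v})"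

definition strongly_convex :: "'n::real_vector set \<Rightarrow> bool" where
  "strongly_convex \<sigma> \<longleftrightarrow> \<sigma> \<inter> uminus ` \<sigma> = {0}"

text \<open>The relation \<open>(face_of)\<close> counts the empty set as a face; in a polyhedral
  complex of cones only nonempty faces are meant.\<close>

definition cone_face :: "'n::real_vector set \<Rightarrow> 'n set \<Rightarrow> bool" where
  "cone_face \<tau> \<sigma> \<longleftrightarrow> \<tau> face_of \<sigma> \<and> \<tau> \<noteq> {}"

definition fan :: "'n::real_vector set \<Rightarrow> 'n set set \<Rightarrow> bool" where
  "fan N \<Sigma> \<longleftrightarrow> finite \<Sigma> \<and> \<Sigma> \<noteq> {} \<and>
     (\<forall>\<sigma>\<in>\<Sigma>. cone_in N \<sigma> \<and> strongly_convex \<sigma>) \<and>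
     (\<forall>\<sigma>\<in>\<Sigma>. \<forall>\<tau>. cone_face \<tau> \<sigma> \<longrightarrow> \<tau> \<in> \<Sigma>) \<and>
     (\<forall>\<sigma>\<in>\<Sigma>. \<forall>\<sigma>'\<in>\<Sigma>. cone_face (\<sigma> \<inter> \<sigma>') \<sigma> \<and> cone_face (\<sigma> \<inter> \<sigma>') \<sigma>')"

definition dual_cone ::
  "'m::real_vector set \<Rightarrow> ('m \<Rightarrow> 'n \<Rightarrow> real) \<Rightarrow> 'n::real_vector set \<Rightarrow> 'm set" where
  "dual_cone M pairing \<sigma> = {m \<in> span M. \<forall>v\<in>\<sigma>. 0 \<le> pairing m v}"

definition cone_monoid ::
  "'m::real_vector set \<Rightarrow> ('m \<Rightarrow> 'n \<Rightarrow> real) \<Rightarrow> 'n::real_vector set \<Rightarrow> 'm set" where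
  "cone_monoid M pairing \<sigma> = dual_cone M pairing \<sigma> \<inter> M"

text \<open>The multiplication of \<^typ>\<open>'m \<Rightarrow>\<^sub>0 trop\<close> is convolution. The monoid semiring
  of a submonoid \<open>A\<close> consists of the combinations supported on \<open>A\<close>, so that the
  semirings of \<open>A \<subseteq> B\<close> are literally nested.\<close>

definition monoid_semiring :: "'m::comm_monoid_add set \<Rightarrow> ('m \<Rightarrow>\<^sub>0 trop) set" where
  "monoid_semiring A = {f. Poly_Mapping.keys f \<subseteq> A}"

definition const :: "trop \<Rightarrow> ('m::comm_monoid_add \<Rightarrow>\<^sub>0 trop)" where
  "const a = Poly_Mapping.single 0 a"

definition monoid_homs :: "'m::comm_monoid_add set \<Rightarrow> ('m \<Rightarrow> trop) set" where
  "monoid_homs A = {\<phi> \<in> A \<rightarrow>\<^sub>E UNIV. \<phi> 0 = 1 \<and> (\<forall>a\<in>A. \<forall>b\<in>A. \<phi> (a + b) = \<phi> a * \<phi> b)}"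

definition induced_hom :: "('m \<Rightarrow> trop) \<Rightarrow> ('m::comm_monoid_add \<Rightarrow>\<^sub>0 trop) \<Rightarrow> trop" where
  "induced_hom \<phi> f = (\<Sum>m\<in>Poly_Mapping.keys f. Poly_Mapping.lookup f m * \<phi> m)"

definition kernel_congruence ::
  "'m set \<Rightarrow> ('m \<Rightarrow> trop) \<Rightarrow> (('m::comm_monoid_add \<Rightarrow>\<^sub>0 trop) \<times> ('m \<Rightarrow>\<^sub>0 trop)) set" where
  "kernel_congruence A \<phi> = {(f, g) \<in> monoid_semiring A \<times> monoid_semiring A.
     induced_hom \<phi> f = induced_hom \<phi> g}"

definition pullback_congruence ::
  "'m set \<Rightarrow> (('m::comm_monoid_add \<Rightarrow>\<^sub>0 trop) \<times> ('m \<Rightarrow>\<^sub>0 trop)) set \<Rightarrow>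
    (('m \<Rightarrow>\<^sub>0 trop) \<times> ('m \<Rightarrow>\<^sub>0 trop)) set" where
  "pullback_congruence A P = P \<inter> (monoid_semiring A \<times> monoid_semiring A)"

lemma subsemiring_monoid_semiring:
  fixes A :: "'m::comm_monoid_add set"
  assumes "0 \<in> A" and "\<And>a b. a \<in> A \<Longrightarrow> b \<in> A \<Longrightarrow> a + b \<in> A"
  shows "subsemiring (monoid_semiring A)"
  unfolding subsemiring_def monoid_semiring_def
proof (intro conjI ballI CollectI)
  fix f g :: "'m \<Rightarrow>\<^sub>0 trop"
  assume fg: "f \<in> {f. Poly_Mapping.keys f \<subseteq> A}" "g \<in> {f. Poly_Mapping.keys f \<subseteq> A}"
  then show "Poly_Mapping.keys (f + g) \<subseteq> A"
    using Poly_Mapping.keys_add[of f g] by blast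
  show "Poly_Mapping.keys (f * g) \<subseteq> A"
    using fg Poly_Mapping.keys_mult[of f g] assms(2) by blast
qed (use assms(1) in auto)

lemma subsemiring_cone_monoid:
  assumes "dual_lattices n M N pairing"
  shows "subsemiring (monoid_semiring (cone_monoid M pairing \<sigma>))"
proof (rule subsemiring_monoid_semiring)
  have lin: "linear (\<lambda>m. pairing m v)" for v
    using assms by (auto simp: dual_lattices_def bilinear_def)
  obtain e where M: "M = {\<Sum>i<n. of_int (k i) *\<^sub>R e i | k :: nat \<Rightarrow> int. True}"
    using assms by (auto simp: dual_lattices_def)
  have "0 \<in> M" unfolding M by (auto intro!: exI[of _ "\<lambda>_. 0"])
  then show "0 \<in> cone_monoid M pairing \<sigma>"
    using linear_0[OF lin] by (simp add: cone_monoid_def dual_cone_def span_zero)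
  fix a b assume ab: "a \<in> cone_monoid M pairing \<sigma>" "b \<in> cone_monoid M pairing \<sigma>"
  then obtain k l :: "nat \<Rightarrow> int" where
    "a = (\<Sum>i<n. of_int (k i) *\<^sub>R e i)" "b = (\<Sum>i<n. of_int (l i) *\<^sub>R e i)"
    by (auto simp: cone_monoid_def M)
  then have "a + b = (\<Sum>i<n. of_int (k i + l i) *\<^sub>R e i)"
    by (simp add: sum.distrib scaleR_add_left)
  then have "a + b \<in> M" unfolding M by (intro CollectI exI[of _ "\<lambda>i. k i + l i"] conjI TrueI)
  then show "a + b \<in> cone_monoid M pairing \<sigma>"
    using ab linear_add[OF lin] by (simp add: cone_monoid_def dual_cone_def span_add)
qed

text \<open>The charts \<open>U i\<close> are glued along maps \<open>j i k\<close> from \<open>U i\<close> to \<open>U k\<close>,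
  given whenever \<open>le i k\<close>: points of the disjoint union are identified according to the
  equivalence relation generated by \<open>x \<sim> j i k x\<close>.\<close>

definition glue_rel ::
  "'i set \<Rightarrow> ('i \<Rightarrow> 'i \<Rightarrow> bool) \<Rightarrow> ('i \<Rightarrow> 'a set) \<Rightarrow> ('i \<Rightarrow> 'i \<Rightarrow> 'a \<Rightarrow> 'a) \<Rightarrow>
    (('i \<times> 'a) \<times> ('i \<times> 'a)) set" where
  "glue_rel I le U j = {(p, q). p \<in> Sigma I U \<and> q \<in> Sigma I U \<and>
     equivclp (\<lambda>p q. fst p \<in> I \<and> fst q \<in> I \<and> le (fst p) (fst q) \<and> snd p \<in> U (fst p) \<and>
       snd q = j (fst p) (fst q) (snd p)) p q}"

lemma equiv_glue_rel: "equiv (Sigma I U) (glue_rel I le U j)"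
  unfolding equiv_def refl_on_def sym_def trans_def glue_rel_def
  by (auto intro: equivclp_sym equivclp_trans)

definition quotient_topology :: "'a topology \<Rightarrow> ('a \<Rightarrow> 'b) \<Rightarrow> 'b topology" where
  "quotient_topology X f =
     topology (\<lambda>W. W \<subseteq> f ` topspace X \<and> openin X {x \<in> topspace X. f x \<in> W})"

lemma openin_quotient_topology:
  "openin (quotient_topology X f) W \<longleftrightarrow>
     W \<subseteq> f ` topspace X \<and> openin X {x \<in> topspace X. f x \<in> W}"
proof -
  have "istopology (\<lambda>W. W \<subseteq> f ` topspace X \<and> openin X {x \<in> topspace X. f x \<in> W})"
    unfolding istopology_def
  proof (intro conjI allI impI; (elim conjE)?)
    fix S T
    assume "openin X {x \<in> topspace X. f x \<in> S}" "openin X {x \<in> topspace X. f x \<in> T}"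
    from openin_Int[OF this]
    show "openin X {x \<in> topspace X. f x \<in> S \<inter> T}"
      by (rule back_subst) auto
  next
    fix K
    assume "\<forall>W\<in>K. W \<subseteq> f ` topspace X \<and> openin X {x \<in> topspace X. f x \<in> W}"
    then have "openin X (\<Union>W\<in>K. {x \<in> topspace X. f x \<in> W})" by blast
    then show "openin X {x \<in> topspace X. f x \<in> \<Union>K}"
      by (rule back_subst) auto
  qed auto
  from topology_inverse'[OF this] show ?thesis
    unfolding quotient_topology_def by simp
qed

lemma topspace_quotient_topology: "topspace (quotient_topology X f) = f ` topspace X"
proof
  show "topspace (quotient_topology X f) \<subseteq> f ` topspace X"
    using openin_topspace[of "quotient_topology X f"] unfolding openin_quotient_topology by blast
  have "{x \<in> topspace X. f x \<in> f ` topspace X} = topspace X" by auto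
  then have "openin (quotient_topology X f) (f ` topspace X)"
    by (simp add: openin_quotient_topology)
  then show "f ` topspace X \<subseteq> topspace (quotient_topology X f)" by (rule openin_subset)
qed

lemma quotient_map_quotient_topology: "quotient_map X (quotient_topology X f) f"
  by (auto simp: quotient_map_def topspace_quotient_topology openin_quotient_topology)

definition U_cong ::
  "'m::real_vector set \<Rightarrow> ('m \<Rightarrow> 'n \<Rightarrow> real) \<Rightarrow> 'n::real_vector set \<Rightarrow>
    (('m \<Rightarrow>\<^sub>0 trop) \<times> ('m \<Rightarrow>\<^sub>0 trop)) set topology" where
  "U_cong M pairing \<sigma> = CSpec_T const (monoid_semiring (cone_monoid M pairing \<sigma>))"

definition cong_rel ::
  "'m::real_vector set \<Rightarrow> ('m \<Rightarrow> 'n \<Rightarrow> real) \<Rightarrow> 'n::real_vector set set \<Rightarrow>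
    (('n set \<times> (('m \<Rightarrow>\<^sub>0 trop) \<times> ('m \<Rightarrow>\<^sub>0 trop)) set) \<times>
     ('n set \<times> (('m \<Rightarrow>\<^sub>0 trop) \<times> ('m \<Rightarrow>\<^sub>0 trop)) set)) set" where
  "cong_rel M pairing \<Sigma> =
     glue_rel \<Sigma> cone_face (\<lambda>\<sigma>. topspace (U_cong M pairing \<sigma>))
       (\<lambda>\<tau> \<sigma>. pullback_congruence (cone_monoid M pairing \<sigma>))"

definition X_cong ::
  "'m::real_vector set \<Rightarrow> ('m \<Rightarrow> 'n \<Rightarrow> real) \<Rightarrow> 'n::real_vector set set \<Rightarrow>
    ('n set \<times> (('m \<Rightarrow>\<^sub>0 trop) \<times> ('m \<Rightarrow>\<^sub>0 trop)) set) set topology" where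
  "X_cong M pairing \<Sigma> =
     quotient_topology (sum_topology (U_cong M pairing) \<Sigma>) (\<lambda>p. cong_rel M pairing \<Sigma> `` {p})"

definition U_trop ::
  "'m::real_vector set \<Rightarrow> ('m \<Rightarrow> 'n \<Rightarrow> real) \<Rightarrow> 'n::real_vector set \<Rightarrow> ('m \<Rightarrow> trop) set" where
  "U_trop M pairing \<sigma> = monoid_homs (cone_monoid M pairing \<sigma>)"

definition trop_rel ::
  "'m::real_vector set \<Rightarrow> ('m \<Rightarrow> 'n \<Rightarrow> real) \<Rightarrow> 'n::real_vector set set \<Rightarrow>
    (('n set \<times> ('m \<Rightarrow> trop)) \<times> ('n set \<times> ('m \<Rightarrow> trop))) set" where
  "trop_rel M pairing \<Sigma> =
     glue_rel \<Sigma> cone_face (U_trop M pairing) (\<lambda>\<tau> \<sigma> \<phi>. restrict \<phi> (cone_monoid M pairing \<sigma>))"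

definition X_trop ::
  "'m::real_vector set \<Rightarrow> ('m \<Rightarrow> 'n \<Rightarrow> real) \<Rightarrow> 'n::real_vector set set \<Rightarrow>
    ('n set \<times> ('m \<Rightarrow> trop)) set set" where
  "X_trop M pairing \<Sigma> = Sigma \<Sigma> (U_trop M pairing) // trop_rel M pairing \<Sigma>"

text \<open>A point \<open>x\<close> of \<open>X_trop\<close> is a class of pairs \<open>(\<sigma>, \<phi>)\<close>; it is sent to
  the class of the pairs \<open>(\<sigma>, ker \<phi>)\<close>. As it is regarded as a subspace of
  \<open>X_cong\<close>, no separate topology is put on \<open>X_trop\<close>.\<close>

definition trop_to_cong ::
  "'m::real_vector set \<Rightarrow> ('m \<Rightarrow> 'n \<Rightarrow> real) \<Rightarrow> 'n::real_vector set set \<Rightarrow>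
    ('n set \<times> ('m \<Rightarrow> trop)) set \<Rightarrow>
    ('n set \<times> (('m \<Rightarrow>\<^sub>0 trop) \<times> ('m \<Rightarrow>\<^sub>0 trop)) set) set" where
  "trop_to_cong M pairing \<Sigma> x = cong_rel M pairing \<Sigma> ``
     ((\<lambda>(\<sigma>, \<phi>). (\<sigma>, kernel_congruence (cone_monoid M pairing \<sigma>) \<phi>)) ` x)"

end

theory Submission
  imports Defs
begin

text \<open>
  The points of the chart of a cone \<open>\<sigma>\<close> are the primes \<open>Q\<close> of \<open>\<T>[M\<^sub>\<sigma>]\<close> which separate
  constants, and the tropical points among them are geometric: every element is congruent to a
  constant. Each chart is open in \<open>X\<^sub>\<Sigma>\<close> (\<open>openin_chart_image\<close>), so a point in the closure
  of \<open>P\<close> that lies in a chart is a congruence of that chart which contains a representative of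
  \<open>P\<close> (\<open>closure_of_point\<close>).

  Within one chart, uniqueness comes from the order. Modulo a prime \<open>Q\<close> any two elements are
  comparable, \<open>f + g\<close> being congruent to \<open>f\<close> or to \<open>g\<close>. If two geometric congruences above
  \<open>Q\<close> gave \<open>f\<close> different values, then a constant strictly between them could be comparable to
  \<open>f\<close> in neither way (\<open>geometric_over_prime_unique\<close>).

  For geometric \<open>K\<close> and \<open>K'\<close> in the charts of \<open>\<sigma>\<close> and \<open>\<sigma>'\<close>, the point \<open>P\<close> lies in
  both charts, hence in the chart of \<open>\<tau> = \<sigma> \<inter> \<sigma>'\<close>. It remains to see that \<open>K\<close> and \<open>K'\<close>
  lie there as well. An integral functional \<open>m\<close> that is nonnegative on \<open>\<sigma>\<close>, nonpositive on
  \<open>\<sigma>'\<close>, and zero on either cone exactly along \<open>\<tau>\<close> (\<open>separation\<close>) presents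
  \<open>\<T>[M\<^sub>\<tau>]\<close> as the localization of \<open>\<T>[M\<^sub>\<sigma>]\<close> at \<open>\<chi>\<^sup>m\<close> and of \<open>\<T>[M\<^sub>\<sigma>\<^sub>']\<close> at
  its inverse (\<open>cuts_localization\<close>). The primes of a localization are those modulo which the
  inverted element is nonzero. If \<open>\<chi>\<^sup>m\<close> had value \<open>-\<infinity>\<close> modulo \<open>K\<close>, then modulo \<open>P\<close>
  it would lie below all real constants and its inverse above all of them, so that the inverse
  could have no value in \<open>\<T>\<close> modulo \<open>K'\<close>
  (\<open>opposite_localizations_not_zero\<close>). Hence \<open>K\<close> and \<open>K'\<close> extend to
  geometric congruences of the chart of \<open>\<tau>\<close> above one prime, and these coincide.

  Locating \<open>P\<close> in the chart of a common face requires the generated gluing relation in closed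
  form (\<open>cong_rel_iff\<close>). This rests on the fact that inside the chart of a cone the charts of two
  faces meet in the chart of their intersection (\<open>chart_face_Int\<close>).
\<close>

section \<open>Prime congruences over the tropical semifield\<close>

lemma congruence_refl: "congruence S C \<Longrightarrow> a \<in> S \<Longrightarrow> (a, a) \<in> C"
  by (auto simp: congruence_def equiv_def refl_on_def)

lemma congruence_sym: "congruence S C \<Longrightarrow> (a, b) \<in> C \<Longrightarrow> (b, a) \<in> C"
  by (auto simp: congruence_def equiv_def sym_def)

lemma congruence_trans: "congruence S C \<Longrightarrow> (a, b) \<in> C \<Longrightarrow> (b, d) \<in> C \<Longrightarrow> (a, d) \<in> C"
  by (auto simp: congruence_def equiv_def trans_def)

lemma congruence_subset: "congruence S C \<Longrightarrow> C \<subseteq> S \<times> S"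
  by (simp add: congruence_def)

lemma congruence_total: "subsemiring S \<Longrightarrow> congruence S (S \<times> S)"
  by (auto simp: congruence_def subsemiring_def equiv_def refl_on_def sym_def trans_def)

lemma prime_congruence_twisted:
  assumes "prime_congruence S P" "a \<in> S" "b \<in> S" "e \<in> S" "d \<in> S"
    and "(a * e + b * d, a * d + b * e) \<in> P"
  shows "(a, b) \<in> P \<or> (e, d) \<in> P"
proof (rule ccontr)
  assume "\<not> ?thesis"
  then have "(a, b) \<in> S \<times> S - P" "(e, d) \<in> S \<times> S - P"
    using assms by auto
  then have "twisted_prod (a, b) (e, d) \<in> S \<times> S - P"
    using assms(1) unfolding prime_congruence_def by blast
  then show False
    using assms(6) by simp
qed

lemma prime_congruence_cancel:
  assumes P: "prime_congruence S P" and S: "subsemiring S" "x \<in> S" "a \<in> S" "b \<in> S"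
    and x: "(x, 0) \<notin> P" and xab: "(x * a, x * b) \<in> P"
  shows "(a, b) \<in> P"
  using prime_congruence_twisted[OF P, of x 0 a b] assms by (auto simp: subsemiring_def)

lemma subsemiring_power: "subsemiring S \<Longrightarrow> x \<in> S \<Longrightarrow> x ^ k \<in> S"
  by (induction k) (auto simp: subsemiring_def)

lemma congruence_power: "congruence S C \<Longrightarrow> subsemiring S \<Longrightarrow> (a, b) \<in> C \<Longrightarrow> (a ^ k, b ^ k) \<in> C"
  by (induction k) (auto intro: congruence_refl congruence_mult simp: subsemiring_def)

lemma prime_congruence_mult_zero:
  assumes P: "prime_congruence S P" and S: "subsemiring S" "x \<in> S" "y \<in> S"
    and xy: "(x * y, 0) \<in> P"
  shows "(x, 0) \<in> P \<or> (y, 0) \<in> P"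
  using prime_congruence_twisted[OF P, of x 0 y 0] assms by (auto simp: subsemiring_def)

lemma trop_idem: "(a::trop) + a = a"
  by (cases a) simp_all

text \<open>The order of \<open>\<T>\<close> is encoded by addition, \<open>a \<le> b\<close> being \<open>a + b = b\<close>; so
  this is the existence of a value strictly between two distinct ones.\<close>

lemma trop_between:
  assumes "(a::trop) \<noteq> b"
  obtains d where "a + d = d" "b + d = b" "a \<noteq> d" "b \<noteq> d"
  | d where "b + d = d" "a + d = a" "a \<noteq> d" "b \<noteq> d"
proof (cases a; cases b)
  assume "a = NegInf" "b = NegInf"
  then show thesis using assms by simp
next
  fix r assume "a = NegInf" "b = Fin r"
  then show thesis using that(1)[of "Fin (r - 1)"] by simp
next
  fix r assume "a = Fin r" "b = NegInf"
  then show thesis using that(2)[of "Fin (r - 1)"] by simp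
next
  fix r s assume "a = Fin r" "b = Fin s"
  then show thesis
    using that(1)[of "Fin ((r + s) / 2)"] that(2)[of "Fin ((r + s) / 2)"] assms
    by (cases "r < s") (auto simp: max_def field_simps)
qed

text \<open>The points of \<open>CSpec_T c S\<close>: on classes, injectivity of the structure map says that
  distinct constants are not congruent.\<close>

definition T_prime :: "(trop \<Rightarrow> 'a) \<Rightarrow> 'a::comm_semiring_1 set \<Rightarrow> ('a \<times> 'a) set \<Rightarrow> bool" where
  "T_prime c S P \<longleftrightarrow> prime_congruence S P \<and> (\<forall>a b. (c a, c b) \<in> P \<longrightarrow> a = b)"

text \<open>Surjectivity of the structure map onto the quotient. Together with \<open>T_prime\<close> it makes the
  quotient isomorphic to \<open>\<T>\<close>.\<close>

definition geometric :: "(trop \<Rightarrow> 'a) \<Rightarrow> 'a set \<Rightarrow> ('a \<times> 'a) set \<Rightarrow> bool" where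
  "geometric c S P \<longleftrightarrow> (\<forall>f\<in>S. \<exists>a. (f, c a) \<in> P)"

locale trop_algebra =
  fixes c :: "trop \<Rightarrow> 'a::comm_semiring_1" and S :: "'a set"
  assumes c_zero: "c 0 = 0" and c_one: "c 1 = 1"
    and c_add: "c (a + b) = c a + c b" and c_mult: "c (a * b) = c a * c b"
    and S: "subsemiring S" and c_in: "c a \<in> S"
begin

lemma closed: "0 \<in> S" "1 \<in> S" "a \<in> S \<Longrightarrow> b \<in> S \<Longrightarrow> a + b \<in> S"
  "a \<in> S \<Longrightarrow> b \<in> S \<Longrightarrow> a * b \<in> S"
  using S by (auto simp: subsemiring_def)

lemma idem: "f + f = (f :: 'a)"
proof -
  have "f + f = f * (c 1 + c 1)"
    by (simp only: c_one distrib_left mult_1_right)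
  also have "\<dots> = f"
    by (subst c_add[symmetric]) (simp add: trop_idem c_one)
  finally show ?thesis .
qed

lemma T_prime_D:
  assumes "T_prime c S P"
  shows T_prime_prime: "prime_congruence S P" and T_prime_congruence: "congruence S P"
    and T_prime_inj: "(c a, c b) \<in> P \<Longrightarrow> a = b" and T_prime_1_0: "(1, 0) \<notin> P"
proof -
  show "prime_congruence S P" "congruence S P" and *: "\<And>a b. (c a, c b) \<in> P \<Longrightarrow> a = b"
    using assms by (auto simp: T_prime_def prime_congruence_def)
  show "(1, 0) \<notin> P"
    using *[of 1 0] by (auto simp: c_zero c_one)
qed

lemma topspace_CSpec_T: "topspace (CSpec_T c S) = {P. T_prime c S P}"
proof -
  have "inj (\<lambda>a. P `` {c a}) \<longleftrightarrow> (\<forall>a b. (c a, c b) \<in> P \<longrightarrow> a = b)"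
    if "prime_congruence S P" for P
  proof -
    have "equiv S P"
      using that by (simp add: prime_congruence_def congruence_def)
    then have "P `` {c a} = P `` {c b} \<longleftrightarrow> (c a, c b) \<in> P" for a b
      using c_in by (simp add: eq_equiv_class_iff)
    then show ?thesis
      by (simp add: inj_def)
  qed
  then show ?thesis
    by (auto simp: CSpec_T_def topspace_CSpec[OF S] T_prime_def)
qed

lemma openin_CSpec_T:
  "openin (CSpec_T c S) V \<longleftrightarrow> (\<exists>C. congruence S C \<and> V = {P. T_prime c S P \<and> \<not> C \<subseteq> P})"
proof -
  have "openin (CSpec_T c S) V \<longleftrightarrow>
      (\<exists>C. congruence S C \<and> V = ({P. prime_congruence S P} - Vset S C) \<inter> topspace (CSpec_T c S))"
    unfolding CSpec_T_def openin_subtopology openin_CSpec[OF S] topspace_subtopology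
      topspace_CSpec[OF S] by blast
  moreover have "({P. prime_congruence S P} - Vset S C) \<inter> topspace (CSpec_T c S) =
      {P. T_prime c S P \<and> \<not> C \<subseteq> P}" for C
    unfolding topspace_CSpec_T Vset_def T_prime_def by blast
  ultimately show ?thesis by simp
qed

text \<open>Any set of pairs cuts out a closed set, that of the congruence which it generates.\<close>

lemma openin_CSpec_T_not_subset:
  assumes "D \<subseteq> S \<times> S"
  shows "openin (CSpec_T c S) {P. T_prime c S P \<and> \<not> D \<subseteq> P}"
proof -
  let ?K = "{E. congruence S E \<and> D \<subseteq> E}"
  have "S \<times> S \<in> ?K"
    using assms congruence_total[OF S] by simp
  then have "congruence S (\<Inter>?K)"
    by (intro congruence_Inter) auto
  moreover have "\<Inter>?K \<subseteq> P \<longleftrightarrow> D \<subseteq> P" if "T_prime c S P" for P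
    using T_prime_congruence[OF that] by blast
  then have "{P. T_prime c S P \<and> \<not> D \<subseteq> P} = {P. T_prime c S P \<and> \<not> \<Inter>?K \<subseteq> P}"
    by blast
  ultimately show ?thesis
    unfolding openin_CSpec_T by blast
qed

text \<open>The quotient by a prime congruence is totally ordered: the twisted product of
  \<open>(f + g, f)\<close> and \<open>(f + g, g)\<close> has both components equal to
  \<open>f\<^sup>2 + f g + g\<^sup>2\<close>, because addition is idempotent.\<close>

lemma prime_congruence_dichotomy:
  assumes "prime_congruence S P" "f \<in> S" "g \<in> S"
  shows "(f + g, f) \<in> P \<or> (f + g, g) \<in> P"
proof -
  have "(f + g) * (f + g) + f * g = f * f + g * g + (f * g + f * g + f * g)"
    "(f + g) * g + f * (f + g) = f * f + g * g + (f * g + f * g)"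
    by (simp_all add: algebra_simps)
  then have "(f + g) * (f + g) + f * g = (f + g) * g + f * (f + g)"
    by (simp add: idem)
  moreover have "((f + g) * g + f * (f + g), (f + g) * g + f * (f + g)) \<in> P"
    using assms closed by (intro congruence_refl[of S]) (auto simp: prime_congruence_def)
  ultimately show ?thesis
    using prime_congruence_twisted[OF assms(1), of "f + g" f "f + g" g] assms closed by auto
qed

text \<open>The core of uniqueness. If \<open>f\<close> specializes to \<open>a\<close> in one quotient \<open>\<T>\<close> and to
  \<open>b > a\<close> in the other, a constant \<open>d\<close> with \<open>a < d < b\<close> would be comparable
  to \<open>f\<close> already modulo \<open>R\<close>, which contradicts one of the two values.\<close>

lemma geometric_value_unique:
  assumes R: "prime_congruence S R" and L: "T_prime c S L" "R \<subseteq> L"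
    and L': "T_prime c S L'" "R \<subseteq> L'" and f: "f \<in> S" "(f, c a) \<in> L" "(f, c b) \<in> L'"
  shows "a = b"
proof (rule ccontr)
  assume "a \<noteq> b"
  have *: "f + c d \<in> S" and dich: "(f + c d, f) \<in> R \<or> (f + c d, c d) \<in> R" for d
    using prime_congruence_dichotomy[OF R] f closed c_in by auto
  have val: "e + d = e" if "(f + c d, f) \<in> R" "T_prime c S K" "R \<subseteq> K" "(f, c e) \<in> K" for K d e
  proof (rule T_prime_inj[OF that(2)])
    note K = T_prime_congruence[OF that(2)]
    have "(c (e + d), f + c d) \<in> K"
      using congruence_add[OF K congruence_sym[OF K that(4)] congruence_refl[OF K c_in]]
      by (simp add: c_add)
    then show "(c (e + d), c e) \<in> K"
      using that by (blast intro: congruence_trans[OF K])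
  qed
  have val': "e + d = d" if "(f + c d, c d) \<in> R" "T_prime c S K" "R \<subseteq> K" "(f, c e) \<in> K" for K d e
  proof (rule T_prime_inj[OF that(2)])
    note K = T_prime_congruence[OF that(2)]
    have "(c (e + d), f + c d) \<in> K"
      using congruence_add[OF K congruence_sym[OF K that(4)] congruence_refl[OF K c_in]]
      by (simp add: c_add)
    then show "(c (e + d), c d) \<in> K"
      using that by (blast intro: congruence_trans[OF K])
  qed
  from \<open>a \<noteq> b\<close> show False
  proof (cases rule: trop_between)
    case (1 d)
    then show False
      using dich[of d] val[OF _ L f(2), of d] val'[OF _ L' f(3), of d] by metis
  next
    case (2 d)
    then show False
      using dich[of d] val[OF _ L' f(3), of d] val'[OF _ L f(2), of d] by metis
  qed
qed

lemma geometric_over_prime_unique: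
  assumes R: "prime_congruence S R"
    and L: "T_prime c S L" "geometric c S L" "R \<subseteq> L"
    and L': "T_prime c S L'" "geometric c S L'" "R \<subseteq> L'"
  shows "L = L'"
proof -
  have "A \<subseteq> B" if A: "T_prime c S A" "geometric c S A" "R \<subseteq> A"
    and B: "T_prime c S B" "geometric c S B" "R \<subseteq> B" for A B
  proof
    fix p assume "p \<in> A"
    then obtain f g where p: "p = (f, g)" "(f, g) \<in> A" "f \<in> S" "g \<in> S"
      using congruence_subset[OF T_prime_congruence[OF A(1)]] by blast
    then obtain a b where ab: "(f, c a) \<in> B" "(g, c b) \<in> B"
      using B by (meson geometric_def)
    obtain d where d: "(f, c d) \<in> A"
      using A p by (meson geometric_def)
    then have "(g, c d) \<in> A"
      using p T_prime_congruence[OF A(1)] by (meson congruence_sym congruence_trans)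
    then have "a = d" "b = d"
      using geometric_value_unique[OF R A(1,3) B(1,3)] p d ab by blast+
    then show "p \<in> B"
      using p ab T_prime_congruence[OF B(1)] by (meson congruence_sym congruence_trans)
  qed
  then show ?thesis
    using L L' by blast
qed

end

section \<open>Localization at one element\<close>

text \<open>\<open>S'\<close> is the localization of \<open>S\<close> at \<open>x\<close>, with \<open>y\<close> the inverse of \<open>x\<close>. Passing
  to a face of a cone changes the monoid semiring in this way.\<close>

locale trop_localization = trop_algebra c S + big: trop_algebra c S'
  for c :: "trop \<Rightarrow> 'a::comm_semiring_1" and S S' :: "'a set" and x y :: 'a +
  assumes sub: "S \<subseteq> S'" and x: "x \<in> S" and y: "y \<in> S'" and xy: "x * y = 1"
    and clear: "f \<in> S' \<Longrightarrow> \<exists>k. x ^ k * f \<in> S"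
begin

lemma power_in: "x ^ k \<in> S"
  using S x by (rule subsemiring_power)

lemma clear_mono:
  assumes "x ^ k * f \<in> S" "k \<le> l"
  shows "x ^ l * f \<in> S"
proof -
  have "x ^ l * f = x ^ (l - k) * (x ^ k * f)"
    using assms(2) by (simp add: mult.assoc[symmetric] power_add[symmetric])
  then show ?thesis
    using assms(1) power_in closed by simp
qed

lemma clear2:
  assumes "f \<in> S'" "g \<in> S'"
  obtains k where "x ^ k * f \<in> S" "x ^ k * g \<in> S"
proof -
  obtain k l where "x ^ k * f \<in> S" "x ^ l * g \<in> S"
    using assms clear by blast
  then have "x ^ (max k l) * f \<in> S" "x ^ (max k l) * g \<in> S"
    by (auto intro: clear_mono)
  with that show thesis by blast
qed

lemma unit_cancel:
  assumes R: "congruence S' R" and f: "(x ^ k * f, x ^ k * g) \<in> R"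
  shows "(f, g) \<in> R"
proof -
  have "y ^ k * (x ^ k * h) = h" for h
    by (metis mult.assoc mult.commute mult_1 power_mult_distrib power_one xy)
  moreover have "(y ^ k * (x ^ k * f), y ^ k * (x ^ k * g)) \<in> R"
    using subsemiring_power[OF big.S y] by (intro congruence_mult[OF R] f congruence_refl[OF R])
  ultimately show ?thesis by simp
qed

lemma restrict_T_prime:
  assumes R: "T_prime c S' R"
  shows "T_prime c S (R \<inter> S \<times> S)"
  unfolding T_prime_def prime_congruence_def
proof (intro conjI ballI allI impI)
  have cong: "congruence S' R" by (rule big.T_prime_congruence[OF R])
  show "congruence S (R \<inter> S \<times> S)"
    unfolding congruence_def equiv_def
  proof (intro conjI allI impI)
    show "refl_on S (R \<inter> S \<times> S)"
      using sub by (auto intro!: refl_onI congruence_refl[OF cong])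
    show "sym (R \<inter> S \<times> S)"
      by (rule symI) (auto intro: congruence_sym[OF cong])
    show "trans (R \<inter> S \<times> S)"
      by (rule transI) (auto intro: congruence_trans[OF cong])
  next
    fix f g h l assume "(f, g) \<in> R \<inter> S \<times> S" "(h, l) \<in> R \<inter> S \<times> S"
    then show "(f + h, g + l) \<in> R \<inter> S \<times> S" "(f * h, g * l) \<in> R \<inter> S \<times> S"
      using closed congruence_add[OF cong, of f g h l] congruence_mult[OF cong, of f g h l] by simp_all
  qed simp_all
  show "S \<times> S - (R \<inter> S \<times> S) \<noteq> {}"
    using big.T_prime_1_0[OF R] closed(1,2) by blast
  fix u v assume uv: "u \<in> S \<times> S - (R \<inter> S \<times> S)" "v \<in> S \<times> S - (R \<inter> S \<times> S)"
  then have "u \<in> S' \<times> S' - R" "v \<in> S' \<times> S' - R"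
    using sub by blast+
  then have "twisted_prod u v \<in> S' \<times> S' - R"
    using big.T_prime_prime[OF R] unfolding prime_congruence_def by blast
  moreover have "twisted_prod u v \<in> S \<times> S"
    using uv closed by (cases u; cases v) simp
  ultimately show "twisted_prod u v \<in> S \<times> S - (R \<inter> S \<times> S)"
    by blast
next
  fix a b assume "(c a, c b) \<in> R \<inter> S \<times> S"
  then show "a = b" using big.T_prime_inj[OF R] by blast
qed

lemma restrict_subset_imp_subset:
  assumes R: "congruence S' R" and R': "congruence S' R'" and "R \<inter> S \<times> S \<subseteq> R'"
  shows "R \<subseteq> R'"
proof
  fix p assume "p \<in> R"
  then obtain f g where p: "p = (f, g)" "(f, g) \<in> R" "f \<in> S'" "g \<in> S'"
    using congruence_subset[OF R] by blast
  then obtain k where k: "x ^ k * f \<in> S" "x ^ k * g \<in> S"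
    using clear2 by blast
  have "x ^ k \<in> S'"
    using power_in sub by blast
  then have "(x ^ k * f, x ^ k * g) \<in> R"
    using p by (intro congruence_mult[OF R] congruence_refl[OF R])
  then have "(x ^ k * f, x ^ k * g) \<in> R'"
    using k assms(3) by blast
  then show "p \<in> R'"
    using unit_cancel[OF R'] p by blast
qed

lemma restrict_inj:
  assumes "T_prime c S' R" "T_prime c S' R'" "R \<inter> S \<times> S = R' \<inter> S \<times> S"
  shows "R = R'"
  using restrict_subset_imp_subset[of R R'] restrict_subset_imp_subset[of R' R] assms
    big.T_prime_congruence by blast

lemma not_zero:
  assumes R: "T_prime c S' R"
  shows "(x, 0) \<notin> R"
proof
  note cong = big.T_prime_congruence[OF R]
  assume "(x, 0) \<in> R"
  then have "(x * y, 0 * y) \<in> R"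
    using y by (intro congruence_mult[OF cong] congruence_refl[OF cong])
  then show False
    using big.T_prime_1_0[OF R] xy by simp
qed

definition extend :: "('a \<times> 'a) set \<Rightarrow> ('a \<times> 'a) set" where
  "extend Q = {(f, g) \<in> S' \<times> S'. \<exists>k. (x ^ k * f, x ^ k * g) \<in> Q}"

text \<open>Cancellation modulo a prime congruence makes the extension to the localization
  restrict to the given congruence.\<close>

lemma extend_restrict:
  assumes Q: "T_prime c S Q" and x0: "(x, 0) \<notin> Q"
  shows "extend Q \<inter> S \<times> S = Q"
proof -
  note cong = T_prime_congruence[OF Q] and p = T_prime_prime[OF Q]
  have cancel: "(x ^ k * f, x ^ k * g) \<in> Q \<Longrightarrow> (f, g) \<in> Q" if "f \<in> S" "g \<in> S" for k f g
  proof (induction k)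
    case (Suc k)
    have "(x * (x ^ k * f), x * (x ^ k * g)) \<in> Q"
      using Suc.prems by (simp add: mult.assoc)
    then have "(x ^ k * f, x ^ k * g) \<in> Q"
      by (rule prime_congruence_cancel[OF p S x closed(4)[OF power_in that(1)]
            closed(4)[OF power_in that(2)] x0])
    then show ?case by (rule Suc.IH)
  qed simp
  show ?thesis
  proof
    show "extend Q \<inter> S \<times> S \<subseteq> Q"
      using cancel by (auto simp: extend_def)
    show "Q \<subseteq> extend Q \<inter> S \<times> S"
    proof
      fix u assume u: "u \<in> Q"
      then obtain f g where "u = (f, g)" "f \<in> S" "g \<in> S"
        using congruence_subset[OF cong] by blast
      moreover from this u have "(x ^ 0 * f, x ^ 0 * g) \<in> Q" by simp
      ultimately show "u \<in> extend Q \<inter> S \<times> S"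
        using sub unfolding extend_def by blast
    qed
  qed
qed

lemma extend_T_prime:
  assumes Q: "T_prime c S Q" and x0: "(x, 0) \<notin> Q"
  shows "T_prime c S' (extend Q)"
proof -
  note cong = T_prime_congruence[OF Q] and p = T_prime_prime[OF Q]
  have mono: "(x ^ l * f, x ^ l * g) \<in> Q" if "(x ^ k * f, x ^ k * g) \<in> Q" "k \<le> l" for k l f g
  proof -
    have "x ^ l * h = x ^ (l - k) * (x ^ k * h)" for h
      using that(2) by (simp add: mult.assoc[symmetric] power_add[symmetric])
    then show ?thesis
      using congruence_mult[OF cong congruence_refl[OF cong power_in] that(1), of "l - k"] by simp
  qed
  have ext: "(f, g) \<in> extend Q \<longleftrightarrow> f \<in> S' \<and> g \<in> S' \<and> (\<exists>k. (x ^ k * f, x ^ k * g) \<in> Q)" for f g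
    by (auto simp: extend_def)
  have refl: "refl_on S' (extend Q)"
  proof (rule refl_onI)
    fix f assume f: "f \<in> S'"
    then show "(f, f) \<in> extend Q"
      using clear[OF f] congruence_refl[OF cong] unfolding ext by blast
  qed
  have sym: "sym (extend Q)"
    by (rule symI) (auto simp: ext intro: congruence_sym[OF cong])
  have trans: "trans (extend Q)"
  proof (rule transI)
    fix f g h assume fg: "(f, g) \<in> extend Q" and gh: "(g, h) \<in> extend Q"
    then obtain k l where "(x ^ k * f, x ^ k * g) \<in> Q" "(x ^ l * g, x ^ l * h) \<in> Q"
      unfolding ext by blast
    then have "(x ^ max k l * f, x ^ max k l * g) \<in> Q" "(x ^ max k l * g, x ^ max k l * h) \<in> Q"
      by (auto intro: mono)
    then show "(f, h) \<in> extend Q"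
      using fg gh congruence_trans[OF cong] unfolding ext by blast
  qed
  have add: "(f + h, g + l) \<in> extend Q"
    if fg: "(f, g) \<in> extend Q" and hl: "(h, l) \<in> extend Q" for f g h l
  proof -
    obtain i j where "(x ^ i * f, x ^ i * g) \<in> Q" "(x ^ j * h, x ^ j * l) \<in> Q"
      using fg hl unfolding ext by blast
    then have "(x ^ max i j * f, x ^ max i j * g) \<in> Q" "(x ^ max i j * h, x ^ max i j * l) \<in> Q"
      by (auto intro: mono)
    from congruence_add[OF cong this] have "(x ^ max i j * (f + h), x ^ max i j * (g + l)) \<in> Q"
      by (simp add: distrib_left)
    then show ?thesis
      using fg hl big.closed unfolding ext by blast
  qed
  have mult: "(f * h, g * l) \<in> extend Q"
    if fg: "(f, g) \<in> extend Q" and hl: "(h, l) \<in> extend Q" for f g h l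
  proof -
    obtain i j where "(x ^ i * f, x ^ i * g) \<in> Q" "(x ^ j * h, x ^ j * l) \<in> Q"
      using fg hl unfolding ext by blast
    from congruence_mult[OF cong this] have "(x ^ (i + j) * (f * h), x ^ (i + j) * (g * l)) \<in> Q"
      by (simp add: power_add mult_ac)
    then show ?thesis
      using fg hl big.closed unfolding ext by blast
  qed
  have ext_cong: "congruence S' (extend Q)"
    unfolding congruence_def equiv_def
  proof (intro conjI allI impI)
    show "extend Q \<subseteq> S' \<times> S'"
      by (auto simp: extend_def)
    then show "extend Q \<subseteq> S' \<times> S'" .
  qed (use refl sym trans add mult in blast)+
  have inj: "a = b" if "(c a, c b) \<in> extend Q" for a b
    using that extend_restrict[OF Q x0] c_in T_prime_inj[OF Q] by blast
  have prime: "(f, g) \<in> extend Q \<or> (h, l) \<in> extend Q"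
    if S': "f \<in> S'" "g \<in> S'" "h \<in> S'" "l \<in> S'"
      and tw: "(f * h + g * l, f * l + g * h) \<in> extend Q" for f g h l
  proof -
    obtain i where i: "x ^ i * f \<in> S" "x ^ i * g \<in> S"
      using clear2 S' by blast
    obtain j where j: "x ^ j * h \<in> S" "x ^ j * l \<in> S"
      using clear2 S' by blast
    obtain k where k: "(x ^ k * (f * h + g * l), x ^ k * (f * l + g * h)) \<in> Q"
      using tw unfolding ext by blast
    let ?i = "i + k"
    have "(x ^ (?i + j) * (f * h + g * l), x ^ (?i + j) * (f * l + g * h)) \<in> Q"
      using k by (rule mono) simp
    moreover have "x ^ (?i + j) * (a * b + d * e) =
        (x ^ ?i * a) * (x ^ j * b) + (x ^ ?i * d) * (x ^ j * e)" for a b d e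
      by (simp add: power_add distrib_left mult_ac)
    ultimately have "((x ^ ?i * f) * (x ^ j * h) + (x ^ ?i * g) * (x ^ j * l),
        (x ^ ?i * f) * (x ^ j * l) + (x ^ ?i * g) * (x ^ j * h)) \<in> Q"
      by simp
    moreover have "x ^ ?i * f \<in> S" "x ^ ?i * g \<in> S"
      using i by (auto intro: clear_mono)
    ultimately have "(x ^ ?i * f, x ^ ?i * g) \<in> Q \<or> (x ^ j * h, x ^ j * l) \<in> Q"
      using j by (intro prime_congruence_twisted[OF p])
    then show ?thesis
      using S' unfolding ext by blast
  qed
  have ne: "S' \<times> S' - extend Q \<noteq> {}"
  proof -
    have "(c 0, c 1) \<notin> extend Q"
      using inj[of 0 1] by auto
    then show ?thesis
      using big.c_in by blast
  qed
  have "twisted_prod u v \<in> S' \<times> S' - extend Q"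
    if u: "u \<in> S' \<times> S' - extend Q" and v: "v \<in> S' \<times> S' - extend Q" for u v
  proof (cases u; cases v)
    fix f g h l assume uv: "u = (f, g)" "v = (h, l)"
    with u v have S': "f \<in> S'" "g \<in> S'" "h \<in> S'" "l \<in> S'" by auto
    then show ?thesis
      using prime[OF S'] u v uv by (auto intro: big.closed)
  qed
  with ext_cong inj ne show ?thesis
    unfolding T_prime_def prime_congruence_def by blast
qed

lemma restrict_image:
  "{R \<inter> S \<times> S | R. T_prime c S' R} = {Q. T_prime c S Q \<and> (x, 0) \<notin> Q}"
proof (intro set_eqI iffI)
  fix Q assume "Q \<in> {R \<inter> S \<times> S | R. T_prime c S' R}"
  then obtain R where "Q = R \<inter> S \<times> S" "T_prime c S' R" by blast
  then show "Q \<in> {Q. T_prime c S Q \<and> (x, 0) \<notin> Q}"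
    using restrict_T_prime[of R] not_zero[of R] by simp
next
  fix Q assume "Q \<in> {Q. T_prime c S Q \<and> (x, 0) \<notin> Q}"
  then have "T_prime c S' (extend Q)" "Q = extend Q \<inter> S \<times> S"
    using extend_T_prime[of Q] extend_restrict[of Q] by simp_all
  then show "Q \<in> {R \<inter> S \<times> S | R. T_prime c S' R}" by blast
qed

text \<open>Restriction to \<open>S\<close> is an open map: the whole image is the locus where \<open>x\<close> is nonzero, and
  the condition \<open>C \<subseteq> R\<close> can be tested on those multiples of pairs in \<open>C\<close> by powers of
  the unit \<open>x\<close> that lie in \<open>S\<close>.\<close>

lemma openin_restrict_image:
  assumes C: "C \<subseteq> S' \<times> S'"
  shows "openin (CSpec_T c S) {R \<inter> S \<times> S | R. T_prime c S' R \<and> \<not> C \<subseteq> R}"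
proof -
  let ?C = "{(x ^ k * f, x ^ k * g) | k f g. (f, g) \<in> C} \<inter> S \<times> S"
  have *: "C \<subseteq> R \<longleftrightarrow> ?C \<subseteq> R \<inter> S \<times> S" if R: "T_prime c S' R" for R
  proof
    note cong = big.T_prime_congruence[OF R]
    assume "C \<subseteq> R"
    have "(x ^ k * f, x ^ k * g) \<in> R" if fg: "(f, g) \<in> C" for k f g
    proof (rule congruence_mult[OF cong])
      show "(x ^ k, x ^ k) \<in> R"
        using power_in sub by (intro congruence_refl[OF cong]) blast
      show "(f, g) \<in> R"
        using fg \<open>C \<subseteq> R\<close> by blast
    qed
    then show "?C \<subseteq> R \<inter> S \<times> S" by blast
  next
    assume CR: "?C \<subseteq> R \<inter> S \<times> S"
    show "C \<subseteq> R"
    proof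
      fix p assume p: "p \<in> C"
      then obtain f g where fg: "p = (f, g)" "f \<in> S'" "g \<in> S'"
        using C by blast
      then obtain k where k: "x ^ k * f \<in> S" "x ^ k * g \<in> S"
        using clear2 by blast
      then have "(x ^ k * f, x ^ k * g) \<in> R"
        using p fg CR by blast
      then show "p \<in> R"
        using unit_cancel[OF big.T_prime_congruence[OF R]] fg by blast
    qed
  qed
  have "{R \<inter> S \<times> S | R. T_prime c S' R \<and> \<not> C \<subseteq> R} =
      {R \<inter> S \<times> S | R. T_prime c S' R} \<inter> {Q. T_prime c S Q \<and> \<not> ?C \<subseteq> Q}"
  proof (intro set_eqI iffI)
    fix Q assume "Q \<in> {R \<inter> S \<times> S | R. T_prime c S' R \<and> \<not> C \<subseteq> R}"
    then obtain R where "Q = R \<inter> S \<times> S" "T_prime c S' R" "\<not> C \<subseteq> R" by blast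
    then show "Q \<in> {R \<inter> S \<times> S | R. T_prime c S' R} \<inter> {Q. T_prime c S Q \<and> \<not> ?C \<subseteq> Q}"
      using *[of R] restrict_T_prime[of R] by (intro IntI CollectI exI[of _ R]) simp_all
  next
    fix Q
    assume Q: "Q \<in> {R \<inter> S \<times> S | R. T_prime c S' R} \<inter> {Q. T_prime c S Q \<and> \<not> ?C \<subseteq> Q}"
    then obtain R where R: "Q = R \<inter> S \<times> S" "T_prime c S' R" by blast
    then show "Q \<in> {R \<inter> S \<times> S | R. T_prime c S' R \<and> \<not> C \<subseteq> R}"
      using *[of R] Q by (intro CollectI exI[of _ R]) simp
  qed
  also have "\<dots> = {Q. T_prime c S Q \<and> \<not> {(x, 0)} \<subseteq> Q} \<inter> {Q. T_prime c S Q \<and> \<not> ?C \<subseteq> Q}"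
    unfolding restrict_image by blast
  finally show ?thesis
    by (simp only:) (intro openin_Int openin_CSpec_T_not_subset; use x closed in blast)
qed

text \<open>If \<open>x\<close> takes a value \<open>r\<close>, then \<open>y\<close> takes the value \<open>- r\<close>, so that no new values
  arise in the localization.\<close>

lemma extend_geometric:
  assumes Q: "T_prime c S Q" "geometric c S Q" and x0: "(x, 0) \<notin> Q"
  shows "geometric c S' (extend Q)"
  unfolding geometric_def
proof
  fix f assume f: "f \<in> S'"
  note L = big.T_prime_congruence[OF extend_T_prime[OF Q(1) x0]]
  have QL: "Q \<subseteq> extend Q"
    using extend_restrict[OF Q(1) x0] by blast
  obtain a where a: "(x, c a) \<in> Q"
    using Q(2) x by (meson geometric_def)
  with x0 c_zero have "a \<noteq> NegInf"
    by (auto simp: zero_trop_def)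
  then obtain r where r: "a = Fin r"
    by (cases a) auto
  let ?u = "Fin (- r)"
  have yu: "y * (x * c ?u) = c ?u"
    by (metis mult.commute mult.left_commute mult_1 xy)
  have cc: "c a * c ?u = 1"
    using r c_mult[of a ?u] by (simp add: one_trop_def[symmetric] c_one)
  have "(y * (x * c ?u), y * (c a * c ?u)) \<in> extend Q"
    using a QL y big.c_in by (intro congruence_mult[OF L] congruence_refl[OF L]) auto
  then have y: "(y, c ?u) \<in> extend Q"
    unfolding yu cc by (simp add: congruence_sym[OF L])
  obtain k where k: "x ^ k * f \<in> S"
    using clear f by blast
  then obtain b where b: "(x ^ k * f, c b) \<in> Q"
    using Q(2) by (meson geometric_def)
  have c_power: "c (e ^ k) = c e ^ k" for e k
    by (induction k) (simp_all add: c_one c_mult)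
  have "(y ^ k * (x ^ k * f), c ?u ^ k * c b) \<in> extend Q"
    using b QL by (intro congruence_mult[OF L] congruence_power[OF L big.S] y) auto
  moreover have "y ^ k * (x ^ k * f) = f"
    by (metis mult.assoc mult.commute mult_1 power_mult_distrib power_one xy)
  ultimately show "\<exists>a. (f, c a) \<in> extend Q"
    by (metis c_mult c_power)
qed

end

text \<open>Here \<open>T\<close> arises from \<open>S\<close> by inverting \<open>x\<close>, and from \<open>S'\<close> by inverting the
  inverse \<open>y\<close> of \<open>x\<close>. If \<open>x\<close> took the value \<open>-\<infinity>\<close> in \<open>K\<close>, then \<open>y\<close> would
  exceed every constant modulo \<open>R\<close>; but its value in \<open>K'\<close> is an element of \<open>\<T>\<close>. This
  replaces the valuative criterion of separatedness.\<close>

lemma opposite_localizations_not_zero: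
  assumes "trop_localization c S T x y" and "trop_localization c S' T y x"
    and R: "T_prime c T R"
    and K: "T_prime c S K" "R \<inter> S \<times> S \<subseteq> K"
    and K': "T_prime c S' K'" "geometric c S' K'" "R \<inter> S' \<times> S' \<subseteq> K'"
  shows "(x, 0) \<notin> K"
proof
  interpret A: trop_localization c S T x y by fact
  interpret B: trop_localization c S' T y x by fact
  note cR = A.big.T_prime_congruence[OF R]
  note cK = A.T_prime_congruence[OF K(1)] and cK' = B.T_prime_congruence[OF K'(1)]
  assume x0: "(x, 0) \<in> K"
  obtain b where b: "(y, c b) \<in> K'"
    using K'(2) B.x by (meson geometric_def)
  define d where "d = (case b of NegInf \<Rightarrow> Fin 0 | Fin r \<Rightarrow> Fin (r + 1))"
  have d: "b + d \<noteq> b"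
    by (simp add: d_def split: trop.split)
  have "(y + c d, y) \<notin> R"
  proof
    assume "(y + c d, y) \<in> R"
    then have "(y + c d, y) \<in> K'"
      using K'(3) B.x B.closed B.c_in by blast
    moreover have "(c b + c d, y + c d) \<in> K'"
      by (rule congruence_add[OF cK' congruence_sym[OF cK' b] congruence_refl[OF cK' B.c_in]])
    ultimately have "(c (b + d), c b) \<in> K'"
      using congruence_trans[OF cK' _ congruence_trans[OF cK' _ b]] by (simp add: B.c_add)
    then show False
      using B.T_prime_inj[OF K'(1)] d by blast
  qed
  then have "(y + c d, c d) \<in> R"
    using A.big.prime_congruence_dichotomy[OF A.big.T_prime_prime[OF R], of y "c d"]
      A.y A.big.c_in by blast
  then have "(x * (y + c d), x * c d) \<in> R"
    using A.x A.sub by (intro congruence_mult[OF cR] congruence_refl[OF cR]) auto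
  then have "(1 + x * c d, x * c d) \<in> R"
    by (simp add: distrib_left A.xy)
  then have 1: "(1 + x * c d, x * c d) \<in> K"
    using K(2) A.closed A.x A.c_in by blast
  have 2: "(x * c d, 0) \<in> K"
    using congruence_mult[OF cK x0 congruence_refl[OF cK A.c_in]] by simp
  have "(1 + x * c d, 1 + 0) \<in> K"
    using 2 A.closed by (intro congruence_add[OF cK] congruence_refl[OF cK])
  then have "(1, 0) \<in> K"
    using congruence_trans[OF cK congruence_sym[OF cK] congruence_trans[OF cK 1 2]] by simp
  then show False
    using A.T_prime_1_0[OF K(1)] by blast
qed

section \<open>Integral separation of rational cones\<close>

text \<open>Farkas' lemma over the integers, by induction on the number of functionals. If the
  functionals other than \<open>l j\<close> do not suffice, some \<open>z\<close> satisfies their inequalities but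
  \<open>l j z < 0\<close>; composing all functionals with \<open>x \<mapsto> - l j z \<cdot> x + l j x \<cdot> z\<close>,
  a multiple of the projection to the kernel of \<open>l j\<close> along \<open>z\<close>, removes \<open>l j\<close>. This map
  preserves the lattice, so that no denominators have to be cleared.\<close>

lemma integral_farkas:
  fixes M :: "'m::real_vector set" and l :: "'i \<Rightarrow> 'm \<Rightarrow> real"
  assumes "finite I"
    and M: "\<And>x y. x \<in> M \<Longrightarrow> y \<in> M \<Longrightarrow> x + y \<in> M"
      "\<And>k x. k \<in> \<int> \<Longrightarrow> x \<in> M \<Longrightarrow> k *\<^sub>R x \<in> M"
    and "\<And>i. i \<in> I \<Longrightarrow> linear (l i)" "\<And>i x. i \<in> I \<Longrightarrow> x \<in> M \<Longrightarrow> l i x \<in> \<int>"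
    and "linear g" "\<And>x. x \<in> M \<Longrightarrow> g x \<in> \<int>"
    and "\<And>x. x \<in> M \<Longrightarrow> (\<And>i. i \<in> I \<Longrightarrow> 0 \<le> l i x) \<Longrightarrow> 0 \<le> g x"
  shows "\<exists>a. (\<forall>i\<in>I. 0 \<le> a i) \<and> (\<forall>x\<in>M. g x = (\<Sum>i\<in>I. a i * l i x))"
  using assms(1,4-)
proof (induction I arbitrary: l g rule: finite_induct)
  case empty
  have "g x = 0" if x: "x \<in> M" for x
  proof -
    have "(-1) *\<^sub>R x \<in> M"
      using x by (intro M(2)) auto
    then have "0 \<le> g (- x)"
      using empty.prems(5) by simp
    then show ?thesis
      using empty.prems(5)[OF x] by (simp add: linear_neg[OF empty.prems(3)])
  qed
  then show ?case by simp
next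
  case (insert j I)
  note lin_l = insert.prems(1) and int_l = insert.prems(2)
    and lin_g = insert.prems(3) and int_g = insert.prems(4) and pos = insert.prems(5)
  show ?case
  proof (cases "\<forall>x\<in>M. (\<forall>i\<in>I. 0 \<le> l i x) \<longrightarrow> 0 \<le> g x")
    case True
    have "\<exists>a. (\<forall>i\<in>I. 0 \<le> a i) \<and> (\<forall>x\<in>M. g x = (\<Sum>i\<in>I. a i * l i x))"
      using True lin_l int_l lin_g int_g by (intro insert.IH) auto
    then obtain a where a: "\<forall>i\<in>I. 0 \<le> a i" "\<forall>x\<in>M. g x = (\<Sum>i\<in>I. a i * l i x)"
      by blast
    have "(\<Sum>i\<in>I. (a(j := 0)) i * l i x) = (\<Sum>i\<in>I. a i * l i x)" for x
      using insert.hyps(2) by (intro sum.cong) auto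
    then show ?thesis
      using a insert.hyps by (intro exI[of _ "a(j := 0)"]) simp
  next
    case False
    then obtain z where z: "z \<in> M" "\<And>i. i \<in> I \<Longrightarrow> 0 \<le> l i z" "g z < 0"
      by force
    define q where "q = - l j z"
    have q: "0 < q" "q \<in> \<int>"
      using pos[OF z(1)] z int_l[of j z] by (force simp: q_def not_le[symmetric])+
    define \<pi> where "\<pi> x = q *\<^sub>R x + l j x *\<^sub>R z" for x
    have \<pi>_M: "\<pi> x \<in> M" if "x \<in> M" for x
      unfolding \<pi>_def using that z(1) q(2) int_l by (intro M) auto
    have \<pi>_lin: "linear \<pi>"
      unfolding \<pi>_def using linear_add[OF lin_l[of j]] linear_scale[OF lin_l[of j]]
      by (intro linearI) (auto simp: algebra_simps)
    have lin_\<pi>: "f (\<pi> x) = q * f x + l j x * f z" if "linear f" for f :: "'m \<Rightarrow> real" and x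
      by (simp add: \<pi>_def linear_add[OF that] linear_scale[OF that])
    have "\<exists>a. (\<forall>i\<in>I. 0 \<le> a i) \<and> (\<forall>x\<in>M. (g \<circ> \<pi>) x = (\<Sum>i\<in>I. a i * (l i \<circ> \<pi>) x))"
    proof (rule insert.IH)
      show "linear (l i \<circ> \<pi>)" if "i \<in> I" for i
        using \<pi>_lin lin_l that by (intro linear_compose) auto
      show "linear (g \<circ> \<pi>)"
        using \<pi>_lin lin_g by (intro linear_compose)
      show "(l i \<circ> \<pi>) x \<in> \<int>" if "i \<in> I" "x \<in> M" for i x
        using that \<pi>_M int_l by simp
      show "(g \<circ> \<pi>) x \<in> \<int>" if "x \<in> M" for x
        using that \<pi>_M int_g by simp
      fix x assume x: "x \<in> M" "\<And>i. i \<in> I \<Longrightarrow> 0 \<le> (l i \<circ> \<pi>) x"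
      have "l j (\<pi> x) = 0"
        by (simp add: lin_\<pi> lin_l q_def)
      have "0 \<le> g (\<pi> x)"
      proof (rule pos[OF \<pi>_M[OF x(1)]])
        show "0 \<le> l i (\<pi> x)" if "i \<in> insert j I" for i
          using that x(2)[of i] \<open>l j (\<pi> x) = 0\<close> by (cases "i = j") auto
      qed
      then show "0 \<le> (g \<circ> \<pi>) x"
        by simp
    qed
    then obtain a where a: "\<And>i. i \<in> I \<Longrightarrow> 0 \<le> a i"
      "\<And>x. x \<in> M \<Longrightarrow> g (\<pi> x) = (\<Sum>i\<in>I. a i * l i (\<pi> x))"
      unfolding comp_def by blast
    \<comment> \<open>The equation for \<open>g \<circ> \<pi>\<close>, solved for \<open>q * g x\<close>.\<close>
    define b where "b = a(j := (\<Sum>i\<in>I. a i * l i z) - g z)"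
    have "q * g x = (\<Sum>i\<in>I. a i * (q * l i x)) + b j * l j x" if x: "x \<in> M" for x
    proof -
      have "q * g x + l j x * g z = (\<Sum>i\<in>I. a i * (q * l i x + l j x * l i z))"
        using a(2)[OF x] by (simp add: lin_\<pi> lin_l lin_g)
      also have "\<dots> = (\<Sum>i\<in>I. a i * (q * l i x)) + l j x * (\<Sum>i\<in>I. a i * l i z)"
        by (simp add: distrib_left sum.distrib sum_distrib_left mult_ac)
      finally show ?thesis
        by (simp add: b_def algebra_simps)
    qed
    moreover have "(\<Sum>i\<in>I. a i * (q * l i x)) = q * (\<Sum>i\<in>I. a i * l i x)" for x
      by (simp add: sum_distrib_left mult_ac)
    ultimately have "g x = (\<Sum>i\<in>I. a i * l i x) + b j / q * l j x" if "x \<in> M" for x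
      using that q(1) by (simp add: field_simps)
    moreover have "(\<Sum>i\<in>I. (a(j := b j / q)) i * l i x) = (\<Sum>i\<in>I. a i * l i x)" for x
      using insert.hyps(2) by (intro sum.cong) auto
    moreover have "0 \<le> (\<Sum>i\<in>I. a i * l i z)"
      using z(2) a(1) by (intro sum_nonneg mult_nonneg_nonneg)
    then have "0 \<le> b j"
      using z(3) by (simp add: b_def)
    ultimately show ?thesis
      using insert.hyps a(1) q(1) by (intro exI[of _ "a(j := b j / q)"]) simp
  qed
qed

lemma convex_cone_sum:
  assumes "convex_cone D" "finite F" "\<And>v. v \<in> F \<Longrightarrow> f v \<in> D"
  shows "(\<Sum>v\<in>F. f v) \<in> D"
  using assms(2,3)
proof (induction F rule: finite_induct)
  case empty
  then show ?case
    using convex_cone_contains_0[OF assms(1)] by simp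
next
  case (insert u F)
  then have "f u + (\<Sum>v\<in>F. f v) \<in> D"
    by (intro convex_cone_add[OF assms(1)]) blast+
  then show ?case
    using insert.hyps by simp
qed

lemma cone_in_generators:
  assumes "cone_in N \<sigma>"
  obtains F where "finite F" "F \<subseteq> N" "F \<subseteq> \<sigma>" "convex_cone \<sigma>"
    "\<sigma> = {\<Sum>v\<in>F. c v *\<^sub>R v | c. \<forall>v\<in>F. 0 \<le> c v}"
proof -
  obtain F where F: "finite F" "F \<subseteq> N"
    and \<sigma>: "\<sigma> = {\<Sum>v\<in>F. c v *\<^sub>R v | c. \<forall>v\<in>F. 0 \<le> c v}"
    using assms unfolding cone_in_def by blast
  have "u \<in> \<sigma>" if "u \<in> F" for u
  proof -
    have "(\<Sum>v\<in>F. (if v = u then 1 else 0) *\<^sub>R v) = u"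
      using F(1) that by (simp add: if_distrib[of "\<lambda>a. a *\<^sub>R _"] cong: if_cong)
    then show ?thesis
      unfolding \<sigma> by (intro CollectI exI[of _ "\<lambda>v. if v = u then 1 else 0"]) simp
  qed
  moreover have "convex_cone \<sigma>"
    unfolding convex_cone_iff
  proof (intro conjI ballI allI impI)
    show "0 \<in> \<sigma>"
      unfolding \<sigma> by (intro CollectI exI[of _ "\<lambda>_. 0"]) simp
    fix u v assume "u \<in> \<sigma>" "v \<in> \<sigma>"
    then obtain a b where "u = (\<Sum>v\<in>F. a v *\<^sub>R v)" "\<forall>v\<in>F. 0 \<le> a v"
      "v = (\<Sum>v\<in>F. b v *\<^sub>R v)" "\<forall>v\<in>F. 0 \<le> b v"
      unfolding \<sigma> by blast
    then show "u + v \<in> \<sigma>"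
      unfolding \<sigma>
      by (intro CollectI exI[of _ "\<lambda>v. a v + b v"]) (simp add: scaleR_add_left sum.distrib)
  next
    fix u and r :: real assume "u \<in> \<sigma>" "0 \<le> r"
    then obtain a where "u = (\<Sum>v\<in>F. a v *\<^sub>R v)" "\<forall>v\<in>F. 0 \<le> a v"
      unfolding \<sigma> by blast
    then show "r *\<^sub>R u \<in> \<sigma>"
      unfolding \<sigma> using \<open>0 \<le> r\<close>
      by (intro CollectI exI[of _ "\<lambda>v. r * a v"]) (simp add: scaleR_right.sum)
  qed
  ultimately show thesis
    using that F \<sigma> by blast
qed

lemma face_of_convex_cone_add:
  assumes \<sigma>: "convex_cone \<sigma>" and \<tau>: "convex_cone \<tau>" "\<tau> face_of \<sigma>"
    and uv: "u \<in> \<sigma>" "v \<in> \<sigma>" "u + v \<in> \<tau>"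
  shows "u \<in> \<tau>"
proof -
  have mid: "midpoint u v \<in> \<tau>"
    unfolding midpoint_def using convex_cone_scaleR[OF \<tau>(1), of "inverse 2"] uv(3) by simp
  show ?thesis
  proof (cases "u = v")
    case True
    with mid show ?thesis by simp
  next
    case False
    have "midpoint u v = (1 - 1 / 2) *\<^sub>R u + (1 / 2) *\<^sub>R v"
      by (simp add: midpoint_def scaleR_add_right inverse_eq_divide)
    with False have "midpoint u v \<in> open_segment u v"
      unfolding in_segment by (intro conjI exI[of _ "1/2"]) auto
    then show ?thesis
      using \<tau>(2) uv mid unfolding face_of_def by blast
  qed
qed

locale lattice_pair =
  fixes n :: nat and M :: "'m::real_vector set" and N :: "'n::real_vector set"
    and pairing :: "'m \<Rightarrow> 'n \<Rightarrow> real"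
  assumes dual: "dual_lattices n M N pairing"
begin

lemma linear_left: "linear (\<lambda>m. pairing m v)" and linear_right: "linear (pairing m)"
  using dual unfolding dual_lattices_def bilinear_def by blast+

lemmas pairing_simps = linear_add[OF linear_left] linear_scale[OF linear_left]
  linear_neg[OF linear_left] linear_diff[OF linear_left] linear_0[OF linear_left]
  linear_sum[OF linear_left]
  linear_add[OF linear_right] linear_scale[OF linear_right] linear_neg[OF linear_right]
  linear_diff[OF linear_right] linear_0[OF linear_right] linear_sum[OF linear_right]

lemma dual_basesE:
  obtains e f where "\<forall>i<n. \<forall>j<n. pairing (e i) (f j) = (if i = j then 1 else 0)"
    "M = {\<Sum>i<n. of_int (k i) *\<^sub>R e i | k. True}" "N = {\<Sum>i<n. of_int (k i) *\<^sub>R f i | k. True}"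
proof -
  from dual obtain e f where
    "\<forall>i<n. \<forall>j<n. pairing (e i) (f j) = (if i = j then 1 else 0)"
    "M = {\<Sum>i<n. of_int (k i) *\<^sub>R e i | k. True}" "N = {\<Sum>i<n. of_int (k i) *\<^sub>R f i | k. True}"
    unfolding dual_lattices_def by (elim conjE exE)
  with that show thesis by blast
qed

lemma integral_span_closed:
  fixes B :: "'b::real_vector set"
  assumes B: "B = {\<Sum>i<n. of_int (k i) *\<^sub>R b i | k :: nat \<Rightarrow> int. True}"
  shows "x \<in> B \<Longrightarrow> y \<in> B \<Longrightarrow> x + y \<in> B" and "r \<in> \<int> \<Longrightarrow> x \<in> B \<Longrightarrow> r *\<^sub>R x \<in> B"
proof -
  assume "x \<in> B" "y \<in> B"
  then obtain k l :: "nat \<Rightarrow> int"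
    where "x = (\<Sum>i<n. of_int (k i) *\<^sub>R b i)" "y = (\<Sum>i<n. of_int (l i) *\<^sub>R b i)"
    unfolding B by blast
  then have "x + y = (\<Sum>i<n. of_int (k i + l i) *\<^sub>R b i)"
    by (simp add: scaleR_add_left sum.distrib)
  then show "x + y \<in> B"
    unfolding B by (intro CollectI exI[of _ "\<lambda>i. k i + l i"]) simp
next
  assume "r \<in> \<int>" "x \<in> B"
  then obtain q :: int and k :: "nat \<Rightarrow> int"
    where "r = of_int q" "x = (\<Sum>i<n. of_int (k i) *\<^sub>R b i)"
    unfolding B by (auto elim!: Ints_cases)
  then have "r *\<^sub>R x = (\<Sum>i<n. of_int (q * k i) *\<^sub>R b i)"
    by (simp add: scaleR_right.sum)
  then show "r *\<^sub>R x \<in> B"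
    unfolding B by (intro CollectI exI[of _ "\<lambda>i. q * k i"]) simp
qed

lemma M_add: "x \<in> M \<Longrightarrow> y \<in> M \<Longrightarrow> x + y \<in> M"
  and M_scale: "k \<in> \<int> \<Longrightarrow> x \<in> M \<Longrightarrow> k *\<^sub>R x \<in> M"
  and N_scale: "k \<in> \<int> \<Longrightarrow> v \<in> N \<Longrightarrow> k *\<^sub>R v \<in> N"
proof -
  obtain e f where M: "M = {\<Sum>i<n. of_int (k i) *\<^sub>R e i | k. True}"
    and N: "N = {\<Sum>i<n. of_int (k i) *\<^sub>R f i | k. True}"
    by (rule dual_basesE)
  show "x \<in> M \<Longrightarrow> y \<in> M \<Longrightarrow> x + y \<in> M" "k \<in> \<int> \<Longrightarrow> x \<in> M \<Longrightarrow> k *\<^sub>R x \<in> M"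
    by (rule integral_span_closed[OF M]; assumption)+
  show "k \<in> \<int> \<Longrightarrow> v \<in> N \<Longrightarrow> k *\<^sub>R v \<in> N"
    by (rule integral_span_closed[OF N])
qed

lemma M_uminus: "x \<in> M \<Longrightarrow> - x \<in> M"
  using M_scale[of "-1" x] by simp

lemma N_uminus: "y \<in> N \<Longrightarrow> - y \<in> N"
  using N_scale[of "-1" y] by simp

lemma M_0: "0 \<in> M"
proof -
  obtain e f where "M = {\<Sum>i<n. of_int (k i) *\<^sub>R e i | k :: nat \<Rightarrow> int. True}"
    by (rule dual_basesE)
  then show ?thesis
    by (auto intro!: exI[of _ "\<lambda>_. 0"])
qed

lemma M_sum: "finite F \<Longrightarrow> (\<And>v. v \<in> F \<Longrightarrow> f v \<in> M) \<Longrightarrow> (\<Sum>v\<in>F. f v) \<in> M"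
  by (induction F rule: finite_induct) (auto simp: M_0 M_add)

lemma pairing_Ints:
  assumes "m \<in> M" "v \<in> N"
  shows "pairing m v \<in> \<int>"
proof -
  obtain e f where ef: "\<forall>i<n. \<forall>j<n. pairing (e i) (f j) = (if i = j then 1 else 0)"
    and M: "M = {\<Sum>i<n. of_int (k i) *\<^sub>R e i | k. True}"
    and N: "N = {\<Sum>i<n. of_int (k i) *\<^sub>R f i | k. True}"
    by (rule dual_basesE)
  from assms obtain k l where "m = (\<Sum>i<n. of_int (k i) *\<^sub>R e i)" "v = (\<Sum>i<n. of_int (l i) *\<^sub>R f i)"
    unfolding M N by blast
  then have "pairing m v = (\<Sum>i<n. \<Sum>j<n. of_int (l i) * (of_int (k j) * pairing (e j) (f i)))"
    by (simp add: pairing_simps sum_distrib_left)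
  also have "\<dots> \<in> \<int>"
    using ef by (intro Ints_sum Ints_mult) auto
  finally show ?thesis .
qed

lemma pairing_nondegenerate:
  assumes w: "w \<in> span N" and 0: "\<And>m. m \<in> M \<Longrightarrow> pairing m w = 0"
  shows "w = 0"
proof -
  obtain e f where ef: "\<forall>i<n. \<forall>j<n. pairing (e i) (f j) = (if i = j then 1 else 0)"
    and M: "M = {\<Sum>i<n. of_int (k i) *\<^sub>R e i | k. True}"
    and N: "N = {\<Sum>i<n. of_int (k i) *\<^sub>R f i | k. True}"
    by (rule dual_basesE)
  \<comment> \<open>Every vector of the span is determined by its pairings with the dual basis.\<close>
  have "w = (\<Sum>i<n. pairing (e i) w *\<^sub>R f i)"
    using w
  proof (induction rule: span_induct_alt)
    case base
    show ?case by (simp add: pairing_simps)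
  next
    case (step r x y)
    then obtain k where x: "x = (\<Sum>i<n. of_int (k i) *\<^sub>R f i)"
      unfolding N by blast
    have "pairing (e i) x = of_int (k i)" if "i < n" for i
      using that by (simp add: x pairing_simps ef if_distrib[of "\<lambda>a. _ * a"] cong: if_cong)
    then have "(\<Sum>i<n. pairing (e i) x *\<^sub>R f i) = x"
      by (simp add: x)
    then have "(\<Sum>i<n. pairing (e i) (r *\<^sub>R x + y) *\<^sub>R f i) =
        r *\<^sub>R x + (\<Sum>i<n. pairing (e i) y *\<^sub>R f i)"
      by (simp add: pairing_simps scaleR_add_left sum.distrib scaleR_right.sum[symmetric]
          flip: scaleR_scaleR)
    then show ?case
      using step.IH by simp
  qed
  moreover have "e i \<in> M" if "i < n" for i
  proof -
    have "(\<Sum>j<n. of_int (if j = i then 1 else 0) *\<^sub>R e j) = e i"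
      using that by (simp add: if_distrib[of of_int] if_distrib[of "\<lambda>a. a *\<^sub>R _"] cong: if_cong)
    then show ?thesis
      unfolding M by (intro CollectI exI[of _ "\<lambda>j. if j = i then 1 else 0"]) simp
  qed
  ultimately show ?thesis
    using 0 by (metis (no_types, lifting) lessThan_iff scaleR_zero_left sum.neutral)
qed

text \<open>The cone generated by \<open>F\<close> is replaced by any convex cone \<open>D\<close> that contains it. For a
  difference of two cones, this avoids describing the elements by combinations of generators.\<close>

lemma lattice_separation:
  assumes F: "finite F" "F \<subseteq> N" and w: "w \<in> N"
    and D: "convex_cone D" "F \<subseteq> D" "w \<notin> D"
  shows "\<exists>m\<in>M. (\<forall>v\<in>F. 0 \<le> pairing m v) \<and> pairing m w < 0"
proof (rule ccontr)
  assume "\<not> ?thesis"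
  then have nonneg: "0 \<le> pairing m w" if "m \<in> M" "\<And>v. v \<in> F \<Longrightarrow> 0 \<le> pairing m v" for m
    using that by (meson not_le)
  have "\<exists>a. (\<forall>v\<in>F. 0 \<le> a v) \<and> (\<forall>m\<in>M. pairing m w = (\<Sum>v\<in>F. a v * pairing m v))"
    using F w by (intro integral_farkas M_add M_scale linear_left pairing_Ints nonneg) auto
  then obtain a where a: "\<forall>v\<in>F. 0 \<le> a v" "\<forall>m\<in>M. pairing m w = (\<Sum>v\<in>F. a v * pairing m v)"
    by blast
  let ?w = "\<Sum>v\<in>F. a v *\<^sub>R v"
  have "w - ?w \<in> span N"
    using F w by (intro span_diff span_sum span_scale) (auto intro: span_base)
  then have "w - ?w = 0"
    by (rule pairing_nondegenerate) (simp add: a pairing_simps)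
  moreover have "?w \<in> D"
    using a F(1) D by (intro convex_cone_sum convex_cone_scaleR) auto
  ultimately show False
    using D(3) by simp
qed

text \<open>The cone \<open>\<sigma> - \<sigma>'\<close> is generated by the generators of \<open>\<sigma>\<close> and the negatives of
  those of \<open>\<sigma>'\<close>. For each generator \<open>u\<close> of \<open>\<sigma>\<close> outside \<open>\<sigma>'\<close> some functional is
  nonnegative on \<open>\<sigma> - \<sigma>'\<close> and positive at \<open>u\<close>; the required one is their sum.\<close>

lemma separation_one_sided:
  assumes \<sigma>: "cone_in N \<sigma>" and \<sigma>': "cone_in N \<sigma>'" and face: "(\<sigma> \<inter> \<sigma>') face_of \<sigma>"
  obtains m where "m \<in> M" "\<And>v. v \<in> \<sigma> \<Longrightarrow> 0 \<le> pairing m v" "\<And>v. v \<in> \<sigma>' \<Longrightarrow> pairing m v \<le> 0"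
    "\<And>v. v \<in> \<sigma> \<Longrightarrow> pairing m v = 0 \<Longrightarrow> v \<in> \<sigma>'"
proof -
  obtain F where F: "finite F" "F \<subseteq> N" "F \<subseteq> \<sigma>" "convex_cone \<sigma>"
    and \<sigma>_eq: "\<sigma> = {\<Sum>v\<in>F. c v *\<^sub>R v | c. \<forall>v\<in>F. 0 \<le> c v}"
    using cone_in_generators[OF \<sigma>] .
  obtain F' where F': "finite F'" "F' \<subseteq> N" "F' \<subseteq> \<sigma>'" "convex_cone \<sigma>'"
    and \<sigma>'_eq: "\<sigma>' = {\<Sum>v\<in>F'. c v *\<^sub>R v | c. \<forall>v\<in>F'. 0 \<le> c v}"
    using cone_in_generators[OF \<sigma>'] .
  let ?G = "F \<union> uminus ` F'" and ?D = "{s - s' | s s'. s \<in> \<sigma> \<and> s' \<in> \<sigma>'}"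
  note z = convex_cone_contains_0[OF F(4)] convex_cone_contains_0[OF F'(4)]
  have int: "convex_cone (\<sigma> \<inter> \<sigma>')"
    using F(4) F'(4) unfolding convex_cone_iff by blast
  have D: "convex_cone ?D"
    unfolding convex_cone_iff
  proof (intro conjI ballI allI impI)
    show "0 \<in> ?D"
      using z by (intro CollectI exI[of _ 0]) simp
    fix u v assume "u \<in> ?D" "v \<in> ?D"
    then obtain s s' t t' where "u = s - s'" "v = t - t'" "s \<in> \<sigma>" "s' \<in> \<sigma>'" "t \<in> \<sigma>" "t' \<in> \<sigma>'"
      by blast
    then show "u + v \<in> ?D"
      by (intro CollectI exI[of _ "s + t"] exI[of _ "s' + t'"])
        (simp add: convex_cone_add[OF F(4)] convex_cone_add[OF F'(4)])
  next
    fix u and r :: real assume "u \<in> ?D" "0 \<le> r"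
    then obtain s s' where "u = s - s'" "s \<in> \<sigma>" "s' \<in> \<sigma>'"
      by blast
    then show "r *\<^sub>R u \<in> ?D"
      using \<open>0 \<le> r\<close> by (intro CollectI exI[of _ "r *\<^sub>R s"] exI[of _ "r *\<^sub>R s'"])
        (simp add: convex_cone_scaleR[OF F(4)] convex_cone_scaleR[OF F'(4)] scaleR_diff_right)
  qed
  have G: "finite ?G" "?G \<subseteq> N"
    using F F' N_uminus by auto
  have GD: "?G \<subseteq> ?D"
  proof
    fix v assume "v \<in> ?G"
    then consider "v \<in> \<sigma>" | v' where "v = - v'" "v' \<in> \<sigma>'"
      using F(3) F'(3) by blast
    then show "v \<in> ?D"
    proof cases
      case 1
      then show ?thesis
        using z(2) by (intro CollectI exI[of _ v] exI[of _ 0]) simp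
    next
      case 2
      then show ?thesis
        using z(1) by (intro CollectI exI[of _ 0] exI[of _ v']) simp
    qed
  qed
  \<comment> \<open>A generator of \<open>\<sigma>\<close> whose negative lies in \<open>\<sigma> - \<sigma>'\<close> is a summand of an element of
    the face \<open>\<sigma> \<inter> \<sigma>'\<close>, hence in that face.\<close>
  have face': "u \<in> \<sigma>'" if u: "u \<in> F" "- u \<in> ?D" for u
  proof -
    from u obtain s s' where s: "- u = s - s'" "s \<in> \<sigma>" "s' \<in> \<sigma>'" by blast
    then have "u + s = s'"
      by (metis add.commute diff_add_cancel minus_diff_eq minus_minus)
    moreover have "u + s \<in> \<sigma>"
      using u(1) F(3) s(2) by (auto intro: convex_cone_add[OF F(4)])
    ultimately have "u + s \<in> \<sigma> \<inter> \<sigma>'"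
      using s(3) by simp
    then have "u \<in> \<sigma> \<inter> \<sigma>'"
      using u(1) F(3) s(2) by (intro face_of_convex_cone_add[OF F(4) int face, of u s]) auto
    then show ?thesis by simp
  qed
  have "\<exists>m. m \<in> M \<and> (\<forall>v\<in>?G. 0 \<le> pairing m v) \<and> 0 < pairing m u" if u: "u \<in> F - \<sigma>'" for u
  proof -
    have "- u \<in> N" "- u \<notin> ?D"
      using u F(2) N_uminus face' by blast+
    from lattice_separation[OF G this(1) D GD this(2)] obtain m where
      "m \<in> M" "\<forall>v\<in>?G. 0 \<le> pairing m v" "pairing m (- u) < 0" by blast
    then show ?thesis
      by (intro exI[of _ m]) (simp add: linear_neg[OF linear_right])
  qed
  then obtain m where m: "\<And>u. u \<in> F - \<sigma>' \<Longrightarrow> m u \<in> M"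
    "\<And>u v. u \<in> F - \<sigma>' \<Longrightarrow> v \<in> ?G \<Longrightarrow> 0 \<le> pairing (m u) v"
    "\<And>u. u \<in> F - \<sigma>' \<Longrightarrow> 0 < pairing (m u) u"
    by metis
  let ?m = "\<Sum>u\<in>F - \<sigma>'. m u"
  have on_G: "0 \<le> pairing ?m v" if "v \<in> ?G" for v
    unfolding pairing_simps using m(2) that by (intro sum_nonneg)
  have "0 \<le> pairing ?m v" if v: "v \<in> \<sigma>" for v
  proof -
    obtain c where "v = (\<Sum>u\<in>F. c u *\<^sub>R u)" "\<forall>u\<in>F. 0 \<le> c u"
      using v unfolding \<sigma>_eq by blast
    then show ?thesis
      using on_G by (auto simp: linear_sum[OF linear_right] linear_scale[OF linear_right]
          intro!: sum_nonneg mult_nonneg_nonneg)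
  qed
  moreover have "pairing ?m v \<le> 0" if v: "v \<in> \<sigma>'" for v
  proof -
    obtain c where c: "v = (\<Sum>u\<in>F'. c u *\<^sub>R u)" "\<forall>u\<in>F'. 0 \<le> c u"
      using v unfolding \<sigma>'_eq by blast
    have "pairing ?m u \<le> 0" if "u \<in> F'" for u
      using on_G[of "- u"] that by (simp add: linear_neg[OF linear_right])
    then show ?thesis
      using c by (auto simp: linear_sum[OF linear_right] linear_scale[OF linear_right]
          intro!: sum_nonpos mult_nonneg_nonpos)
  qed
  moreover have "v \<in> \<sigma>'" if v: "v \<in> \<sigma>" "pairing ?m v = 0" for v
  proof -
    obtain c where c: "v = (\<Sum>u\<in>F. c u *\<^sub>R u)" "\<forall>u\<in>F. 0 \<le> c u"
      using v(1) unfolding \<sigma>_eq by blast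
    then have "(\<Sum>u\<in>F. c u * pairing ?m u) = 0"
      using v(2) by (simp add: linear_sum[OF linear_right] linear_scale[OF linear_right])
    then have 0: "c u * pairing ?m u = 0" if "u \<in> F" for u
      using that c(2) on_G F(1)
      by (subst (asm) sum_nonneg_eq_0_iff) (auto intro!: mult_nonneg_nonneg)
    have "c u *\<^sub>R u \<in> \<sigma>'" if u: "u \<in> F" for u
    proof (cases "u \<in> \<sigma>'")
      case True
      then show ?thesis
        using c(2) u by (intro convex_cone_scaleR[OF F'(4)]) auto
    next
      case False
      then have "0 < pairing ?m u"
        unfolding linear_sum[OF linear_left] using u m F(1)
        by (intro sum_pos2[of _ u]) auto
      then show ?thesis
        using 0[OF u] z by simp
    qed
    then show ?thesis
      unfolding c(1) using F(1) F'(4) by (intro convex_cone_sum)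
  qed
  moreover have "?m \<in> M"
    using m(1) F(1) by (intro M_sum) auto
  ultimately show thesis
    using that by blast
qed

text \<open>The two one-sided separations add up to a two-sided one.\<close>

lemma separation:
  assumes \<sigma>: "cone_in N \<sigma>" "(\<sigma> \<inter> \<sigma>') face_of \<sigma>" and \<sigma>': "cone_in N \<sigma>'" "(\<sigma> \<inter> \<sigma>') face_of \<sigma>'"
  obtains m where "m \<in> M" "\<And>v. v \<in> \<sigma> \<Longrightarrow> 0 \<le> pairing m v" "\<And>v. v \<in> \<sigma>' \<Longrightarrow> pairing m v \<le> 0"
    "\<And>v. v \<in> \<sigma> \<Longrightarrow> pairing m v = 0 \<Longrightarrow> v \<in> \<sigma>'" "\<And>v. v \<in> \<sigma>' \<Longrightarrow> pairing m v = 0 \<Longrightarrow> v \<in> \<sigma>"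
proof -
  obtain m where m: "m \<in> M" "\<And>v. v \<in> \<sigma> \<Longrightarrow> 0 \<le> pairing m v" "\<And>v. v \<in> \<sigma>' \<Longrightarrow> pairing m v \<le> 0"
    "\<And>v. v \<in> \<sigma> \<Longrightarrow> pairing m v = 0 \<Longrightarrow> v \<in> \<sigma>'"
    using separation_one_sided[OF \<sigma>(1) \<sigma>'(1) \<sigma>(2)] by blast
  have "(\<sigma>' \<inter> \<sigma>) face_of \<sigma>'"
    using \<sigma>'(2) by (simp add: Int_commute)
  then obtain m' where m': "m' \<in> M" "\<And>v. v \<in> \<sigma>' \<Longrightarrow> 0 \<le> pairing m' v"
    "\<And>v. v \<in> \<sigma> \<Longrightarrow> pairing m' v \<le> 0" "\<And>v. v \<in> \<sigma>' \<Longrightarrow> pairing m' v = 0 \<Longrightarrow> v \<in> \<sigma>"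
    using separation_one_sided[OF \<sigma>'(1) \<sigma>(1)] by blast
  have p: "pairing (m - m') v = pairing m v - pairing m' v" for v
    by (simp add: linear_diff[OF linear_left])
  show thesis
  proof (rule that[of "m - m'"])
    show "m - m' \<in> M"
      using m(1) m'(1) M_add[of m "- m'"] M_uminus by simp
  next
    fix v assume v: "v \<in> \<sigma>"
    then show "0 \<le> pairing (m - m') v"
      using m(2)[of v] m'(3)[of v] by (simp add: p)
    assume "pairing (m - m') v = 0"
    then show "v \<in> \<sigma>'"
      using m(2,4)[of v] m'(3)[of v] v by (simp add: p)
  next
    fix v assume v: "v \<in> \<sigma>'"
    then show "pairing (m - m') v \<le> 0"
      using m(3)[of v] m'(2)[of v] by (simp add: p)
    assume "pairing (m - m') v = 0"
    then show "v \<in> \<sigma>"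
      using m(3)[of v] m'(2,4)[of v] v by (simp add: p)
  qed
qed

end

section \<open>The charts of a fan\<close>

definition monomial :: "'m::comm_monoid_add \<Rightarrow> ('m \<Rightarrow>\<^sub>0 trop)" where
  "monomial m = Poly_Mapping.single m 1"

lemma monomial_mult: "monomial a * monomial b = monomial (a + b)"
  by (simp add: monomial_def mult_single)

lemma monomial_0: "monomial 0 = 1"
  by (simp add: monomial_def)

lemma monomial_power: "monomial (m :: 'm::real_vector) ^ k = monomial (real k *\<^sub>R m)"
  by (induction k) (simp_all add: monomial_0 monomial_mult scaleR_add_left)

lemma monomial_in_iff: "monomial m \<in> monoid_semiring A \<longleftrightarrow> m \<in> A"
  by (simp add: monomial_def monoid_semiring_def)

lemma induced_hom_const: "\<phi> 0 = 1 \<Longrightarrow> induced_hom \<phi> (const a) = a"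
  by (simp add: induced_hom_def const_def)

lemma image_sliceE:
  assumes "y \<in> f ` ({a} \<times> V)"
  obtains v where "v \<in> V" "y = f (a, v)"
  using assms by auto

lemma cone_face_trans: "cone_face \<rho> \<tau> \<Longrightarrow> cone_face \<tau> \<sigma> \<Longrightarrow> cone_face \<rho> \<sigma>"
  using face_of_trans[of \<rho> \<tau> \<sigma>] by (simp add: cone_face_def)

lemma cone_face_subset: "cone_face \<tau> \<sigma> \<Longrightarrow> \<tau> \<subseteq> \<sigma>"
  unfolding cone_face_def by (elim conjE) (rule face_of_imp_subset)

locale toric_fan = lattice_pair n M N pairing
  for n :: nat and M :: "'m::real_vector set" and N :: "'n::real_vector set"
    and pairing :: "'m \<Rightarrow> 'n \<Rightarrow> real" +
  fixes \<Sigma> :: "'n set set"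
  assumes fan: "fan N \<Sigma>"
begin

abbreviation chart_ring :: "'n set \<Rightarrow> ('m \<Rightarrow>\<^sub>0 trop) set" where
  "chart_ring \<sigma> \<equiv> monoid_semiring (cone_monoid M pairing \<sigma>)"

abbreviation chart_prime :: "'n set \<Rightarrow> (('m \<Rightarrow>\<^sub>0 trop) \<times> ('m \<Rightarrow>\<^sub>0 trop)) set \<Rightarrow> bool" where
  "chart_prime \<sigma> \<equiv> T_prime const (chart_ring \<sigma>)"

abbreviation restrict_to ::
  "'n set \<Rightarrow> (('m \<Rightarrow>\<^sub>0 trop) \<times> ('m \<Rightarrow>\<^sub>0 trop)) set \<Rightarrow> (('m \<Rightarrow>\<^sub>0 trop) \<times> ('m \<Rightarrow>\<^sub>0 trop)) set"
  where "restrict_to \<sigma> R \<equiv> R \<inter> chart_ring \<sigma> \<times> chart_ring \<sigma>"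

lemma cone: "\<sigma> \<in> \<Sigma> \<Longrightarrow> cone_in N \<sigma>"
  and face_in: "\<sigma> \<in> \<Sigma> \<Longrightarrow> cone_face \<tau> \<sigma> \<Longrightarrow> \<tau> \<in> \<Sigma>"
  and Int_face: "\<sigma> \<in> \<Sigma> \<Longrightarrow> \<sigma>' \<in> \<Sigma> \<Longrightarrow> cone_face (\<sigma> \<inter> \<sigma>') \<sigma>"
    "\<sigma> \<in> \<Sigma> \<Longrightarrow> \<sigma>' \<in> \<Sigma> \<Longrightarrow> cone_face (\<sigma> \<inter> \<sigma>') \<sigma>'"
  using fan unfolding fan_def by blast+

lemma cone_face_self: "\<sigma> \<in> \<Sigma> \<Longrightarrow> cone_face \<sigma> \<sigma>"
  using Int_face(1)[of \<sigma> \<sigma>] by simp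

lemma cone_monoid_iff: "m \<in> cone_monoid M pairing \<sigma> \<longleftrightarrow> m \<in> M \<and> (\<forall>v\<in>\<sigma>. 0 \<le> pairing m v)"
  by (auto simp: cone_monoid_def dual_cone_def intro: span_base)

lemma trop_algebra_chart: "trop_algebra const (chart_ring \<sigma>)"
proof
  show "subsemiring (chart_ring \<sigma>)"
    by (rule subsemiring_cone_monoid[OF dual])
  have "0 \<in> cone_monoid M pairing \<sigma>"
    by (simp add: cone_monoid_iff M_0 linear_0[OF linear_left])
  then show "const a \<in> chart_ring \<sigma>" for a
    by (simp add: const_def monoid_semiring_def)
qed (simp_all add: const_def single_add mult_single)

lemma topspace_chart: "topspace (U_cong M pairing \<sigma>) = {P. chart_prime \<sigma> P}"
  unfolding U_cong_def by (rule trop_algebra.topspace_CSpec_T[OF trop_algebra_chart])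

definition cuts :: "'m \<Rightarrow> 'n set \<Rightarrow> 'n set \<Rightarrow> bool" where
  "cuts m \<sigma> \<tau> \<longleftrightarrow> m \<in> cone_monoid M pairing \<sigma> \<and> \<tau> \<subseteq> \<sigma> \<and> (\<forall>v\<in>\<sigma>. pairing m v = 0 \<longleftrightarrow> v \<in> \<tau>)"

lemma face_cut:
  assumes \<sigma>: "\<sigma> \<in> \<Sigma>" and \<tau>: "cone_face \<tau> \<sigma>"
  obtains m where "cuts m \<sigma> \<tau>"
proof -
  have sub: "\<tau> \<subseteq> \<sigma>"
    using \<tau> by (rule cone_face_subset)
  then have "(\<sigma> \<inter> \<tau>) face_of \<sigma>"
    using \<tau> by (simp add: Int_absorb1 cone_face_def)
  then obtain m where m: "m \<in> M" "\<And>v. v \<in> \<sigma> \<Longrightarrow> 0 \<le> pairing m v"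
    "\<And>v. v \<in> \<tau> \<Longrightarrow> pairing m v \<le> 0" "\<And>v. v \<in> \<sigma> \<Longrightarrow> pairing m v = 0 \<Longrightarrow> v \<in> \<tau>"
    using separation_one_sided[OF cone[OF \<sigma>] cone[OF face_in[OF \<sigma> \<tau>]]] by blast
  have "cuts m \<sigma> \<tau>"
    unfolding cuts_def cone_monoid_iff using m sub by (auto intro: antisym)
  then show thesis by (rule that)
qed

text \<open>On a generator of \<open>\<sigma>\<close> outside \<open>\<tau>\<close> the functional \<open>m\<close> is positive, so that adding a
  large multiple of \<open>m\<close> to any element of \<open>M\<^sub>\<tau>\<close> makes it nonnegative on all of \<open>\<sigma>\<close>.\<close>

lemma cuts_localization:
  assumes \<sigma>: "cone_in N \<sigma>" and m: "cuts m \<sigma> \<tau>"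
  shows "trop_localization const (chart_ring \<sigma>) (chart_ring \<tau>) (monomial m) (monomial (- m))"
proof -
  interpret A: trop_algebra const "chart_ring \<sigma>" by (rule trop_algebra_chart)
  interpret B: trop_algebra const "chart_ring \<tau>" by (rule trop_algebra_chart)
  show ?thesis
  proof
    show "chart_ring \<sigma> \<subseteq> chart_ring \<tau>"
      using m by (auto simp: monoid_semiring_def cuts_def cone_monoid_iff subset_iff)
    show "monomial m \<in> chart_ring \<sigma>"
      using m by (simp add: monomial_in_iff cuts_def)
    have "pairing m v = 0" if "v \<in> \<tau>" for v
      using m that unfolding cuts_def by blast
    then show "monomial (- m) \<in> chart_ring \<tau>"
      using m M_uminus by (simp add: monomial_in_iff cuts_def cone_monoid_iff linear_neg[OF linear_left])
    show "monomial m * monomial (- m) = 1"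
      by (simp add: monomial_mult monomial_0)
    fix f assume "f \<in> chart_ring \<tau>"
    then have f: "\<And>u. u \<in> Poly_Mapping.keys f \<Longrightarrow> u \<in> cone_monoid M pairing \<tau>"
      by (auto simp: monoid_semiring_def)
    obtain F where F: "finite F" "F \<subseteq> \<sigma>"
      and \<sigma>_eq: "\<sigma> = {\<Sum>v\<in>F. c v *\<^sub>R v | c. \<forall>v\<in>F. 0 \<le> c v}"
      using cone_in_generators[OF \<sigma>] .
    have "\<forall>\<^sub>F k in sequentially. 0 \<le> pairing u v + real k * pairing m v"
      if u: "u \<in> Poly_Mapping.keys f" and v: "v \<in> F" for u v
    proof (cases "pairing m v = 0")
      case True
      then have "v \<in> \<tau>"
        using m v F(2) by (auto simp: cuts_def)
      then show ?thesis
        using f[OF u] True by (simp add: cone_monoid_iff)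
    next
      case False
      then have pos: "0 < pairing m v"
        using m v F(2) by (auto simp: cuts_def cone_monoid_iff less_le)
      have "\<forall>\<^sub>F k in sequentially. - pairing u v / pairing m v \<le> real k"
        by (rule eventually_sequentiallyI[of "nat \<lceil>- pairing u v / pairing m v\<rceil>"]) linarith
      then show ?thesis
        by eventually_elim (use pos in \<open>simp add: field_simps\<close>)
    qed
    then have "\<forall>\<^sub>F k in sequentially. \<forall>u\<in>Poly_Mapping.keys f. \<forall>v\<in>F.
        0 \<le> pairing u v + real k * pairing m v"
      using F(1) by (intro eventually_ball_finite ballI) auto
    then obtain k where k: "\<And>u v. u \<in> Poly_Mapping.keys f \<Longrightarrow> v \<in> F \<Longrightarrow>
        0 \<le> pairing u v + real k * pairing m v"
      unfolding eventually_sequentially by blast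
    have "real k *\<^sub>R m + u \<in> cone_monoid M pairing \<sigma>" if u: "u \<in> Poly_Mapping.keys f" for u
      unfolding cone_monoid_iff
    proof (intro conjI ballI)
      show "real k *\<^sub>R m + u \<in> M"
        using m f[OF u] by (intro M_add M_scale) (auto simp: cuts_def cone_monoid_iff)
      fix v assume "v \<in> \<sigma>"
      then obtain c where v: "v = (\<Sum>w\<in>F. c w *\<^sub>R w)" and c: "\<forall>w\<in>F. 0 \<le> c w"
        unfolding \<sigma>_eq by blast
      have "0 \<le> pairing (real k *\<^sub>R m + u) w" if "w \<in> F" for w
        using k[OF u that] by (simp add: linear_add[OF linear_left] linear_scale[OF linear_left])
      then show "0 \<le> pairing (real k *\<^sub>R m + u) v"
        unfolding v linear_sum[OF linear_right] linear_scale[OF linear_right]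
        using c by (intro sum_nonneg) auto
    qed
    moreover have "Poly_Mapping.keys (monomial m ^ k * f) \<subseteq> {real k *\<^sub>R m + u | u. u \<in> Poly_Mapping.keys f}"
      using keys_mult[of "monomial (real k *\<^sub>R m)" f]
      unfolding monomial_power by (simp add: monomial_def)
    ultimately have "monomial m ^ k * f \<in> chart_ring \<sigma>"
      unfolding monoid_semiring_def by blast
    then show "\<exists>k. monomial m ^ k * f \<in> chart_ring \<sigma>" by blast
  qed
qed

lemma chart_ring_antimono: "\<tau> \<subseteq> \<sigma> \<Longrightarrow> chart_ring \<sigma> \<subseteq> chart_ring \<tau>"
  by (auto simp: monoid_semiring_def cone_monoid_iff subset_iff)

lemma restrict_to_restrict_to: "\<tau> \<subseteq> \<sigma> \<Longrightarrow> restrict_to \<sigma> (restrict_to \<tau> R) = restrict_to \<sigma> R"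
  using chart_ring_antimono[of \<tau> \<sigma>] by blast

lemma restrict_to_self: "chart_prime \<sigma> R \<Longrightarrow> restrict_to \<sigma> R = R"
  using congruence_subset[OF trop_algebra.T_prime_congruence[OF trop_algebra_chart, of \<sigma> R]] by blast

lemma chart_prime_restrict:
  assumes "\<sigma> \<in> \<Sigma>" "cone_face \<tau> \<sigma>" "chart_prime \<tau> R"
  shows "chart_prime \<sigma> (restrict_to \<sigma> R)"
proof -
  obtain m where "cuts m \<sigma> \<tau>"
    using face_cut assms(1,2) .
  from cuts_localization[OF cone[OF assms(1)] this] show ?thesis
    by (rule trop_localization.restrict_T_prime) fact
qed

lemma chart_restrict_inj:
  assumes "\<sigma> \<in> \<Sigma>" "cone_face \<tau> \<sigma>" "chart_prime \<tau> R" "chart_prime \<tau> R'"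
    "restrict_to \<sigma> R = restrict_to \<sigma> R'"
  shows "R = R'"
proof -
  obtain m where "cuts m \<sigma> \<tau>"
    using face_cut assms(1,2) .
  from cuts_localization[OF cone[OF assms(1)] this] show ?thesis
    by (rule trop_localization.restrict_inj) fact+
qed

text \<open>Inside the chart of \<open>\<sigma>\<close>, the charts of two faces meet in the chart of the intersection:
  if \<open>m\<close> and \<open>m'\<close> cut out the two faces, then \<open>m + m'\<close> cuts out their intersection, and
  \<open>\<chi>\<^sup>m\<close>, \<open>\<chi>\<^sup>m\<^sup>'\<close> nonzero make \<open>\<chi>\<^sup>m\<^sup>+\<^sup>m\<^sup>'\<close> nonzero modulo a prime.\<close>

lemma chart_face_Int:
  assumes \<sigma>: "\<sigma> \<in> \<Sigma>" and \<tau>: "cone_face \<tau> \<sigma>" "cone_face \<tau>' \<sigma>"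
    and R: "chart_prime \<tau> R" "chart_prime \<tau>' R'" "restrict_to \<sigma> R = restrict_to \<sigma> R'"
  obtains T where "chart_prime (\<tau> \<inter> \<tau>') T" "restrict_to \<sigma> T = restrict_to \<sigma> R"
proof -
  interpret A: trop_algebra const "chart_ring \<sigma>" by (rule trop_algebra_chart)
  let ?Q = "restrict_to \<sigma> R"
  obtain m where m: "cuts m \<sigma> \<tau>"
    using face_cut[OF \<sigma> \<tau>(1)] .
  obtain m' where m': "cuts m' \<sigma> \<tau>'"
    using face_cut[OF \<sigma> \<tau>(2)] .
  interpret L: trop_localization const "chart_ring \<sigma>" "chart_ring \<tau>" "monomial m" "monomial (- m)"
    by (rule cuts_localization[OF cone[OF \<sigma>] m])
  interpret L': trop_localization const "chart_ring \<sigma>" "chart_ring \<tau>'" "monomial m'" "monomial (- m')"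
    by (rule cuts_localization[OF cone[OF \<sigma>] m'])
  have Q: "chart_prime \<sigma> ?Q"
    using R(1) by (rule L.restrict_T_prime)
  have "(monomial m, 0) \<notin> ?Q" "(monomial m', 0) \<notin> ?Q"
    using L.not_zero[OF R(1)] L'.not_zero[OF R(2)] R(3) by blast+
  then have nz: "(monomial (m + m'), 0) \<notin> ?Q"
    using prime_congruence_mult_zero[OF A.T_prime_prime[OF Q] A.S L.x L'.x]
    unfolding monomial_mult by blast
  have "cuts (m + m') \<sigma> (\<tau> \<inter> \<tau>')"
    using m m'
    by (auto simp: cuts_def cone_monoid_iff M_add linear_add[OF linear_left] add_nonneg_eq_0_iff)
  from cuts_localization[OF cone[OF \<sigma>] this]
  interpret I: trop_localization const "chart_ring \<sigma>" "chart_ring (\<tau> \<inter> \<tau>')"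
    "monomial (m + m')" "monomial (- (m + m'))" .
  show thesis
    using that I.extend_T_prime[OF Q nz] I.extend_restrict[OF Q nz] by blast
qed

section \<open>Gluing\<close>

abbreviation points where
  "points \<equiv> Sigma \<Sigma> (\<lambda>\<sigma>. topspace (U_cong M pairing \<sigma>))"

abbreviation glued where
  "glued p \<equiv> cong_rel M pairing \<Sigma> `` {p}"

text \<open>An explicit form of the gluing relation, which is generated by single restrictions: two
  points are identified if and only if they come from one point of the chart of a common face.\<close>

definition common_face where
  "common_face p q \<longleftrightarrow> (\<exists>\<rho>\<in>\<Sigma>. cone_face \<rho> (fst p) \<and> cone_face \<rho> (fst q) \<and>
     (\<exists>R. chart_prime \<rho> R \<and> snd p = restrict_to (fst p) R \<and> snd q = restrict_to (fst q) R))"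

lemma common_face_extend:
  assumes "common_face p (\<sigma>, Q)" and "cone_face \<sigma> \<tau>"
  shows "common_face p (\<tau>, restrict_to \<tau> Q)"
proof -
  obtain \<rho> R where \<rho>: "\<rho> \<in> \<Sigma>" "cone_face \<rho> (fst p)" "cone_face \<rho> \<sigma>" "chart_prime \<rho> R"
    "snd p = restrict_to (fst p) R" and Q: "Q = restrict_to \<sigma> R"
    using assms(1) by (auto simp: common_face_def)
  have "restrict_to \<tau> Q = restrict_to \<tau> R"
    unfolding Q by (rule restrict_to_restrict_to[OF cone_face_subset[OF assms(2)]])
  then show ?thesis
    unfolding common_face_def fst_conv snd_conv
    by (intro bexI[of _ \<rho>] conjI exI[of _ R] \<rho> cone_face_trans[OF \<rho>(3) assms(2)])
qed

text \<open>The step of transitivity that goes back along a gluing map. It needs the charts of \<open>\<rho>\<close> and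
  \<open>\<tau>\<close> to meet, inside the chart of \<open>\<sigma>\<close>, in that of \<open>\<rho> \<inter> \<tau>\<close>.\<close>

lemma common_face_restrict:
  assumes p: "common_face p (\<sigma>, restrict_to \<sigma> Q)" "fst p \<in> \<Sigma>" and \<sigma>: "\<sigma> \<in> \<Sigma>"
    and \<tau>: "cone_face \<tau> \<sigma>" and Q: "chart_prime \<tau> Q"
  shows "common_face p (\<tau>, Q)"
proof -
  obtain \<rho> R where \<rho>: "\<rho> \<in> \<Sigma>" "cone_face \<rho> (fst p)" "cone_face \<rho> \<sigma>" and R: "chart_prime \<rho> R"
    "snd p = restrict_to (fst p) R" "restrict_to \<sigma> Q = restrict_to \<sigma> R"
    using p(1) by (auto simp: common_face_def)
  have \<tau>\<Sigma>: "\<tau> \<in> \<Sigma>"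
    using face_in[OF \<sigma> \<tau>] .
  obtain T where T: "chart_prime (\<rho> \<inter> \<tau>) T" "restrict_to \<sigma> T = restrict_to \<sigma> R"
    using chart_face_Int[OF \<sigma> \<rho>(3) \<tau> R(1) Q R(3)[symmetric]] .
  note faces = Int_face[OF \<rho>(1) \<tau>\<Sigma>]
  note sub = cone_face_subset[OF \<rho>(3)] cone_face_subset[OF \<tau>] cone_face_subset[OF \<rho>(2)]
  have "restrict_to \<rho> T = R"
    using sub T R by (intro chart_restrict_inj[OF \<sigma> \<rho>(3) chart_prime_restrict[OF \<rho>(1) faces(1)]])
      (simp_all add: restrict_to_restrict_to)
  then have 1: "snd p = restrict_to (fst p) T"
    using R(2) restrict_to_restrict_to[OF sub(3)] by metis
  have 2: "restrict_to \<tau> T = Q"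
    using sub T R Q by (intro chart_restrict_inj[OF \<sigma> \<tau> chart_prime_restrict[OF \<tau>\<Sigma> faces(2)]])
      (simp_all add: restrict_to_restrict_to)
  show ?thesis
    unfolding common_face_def fst_conv snd_conv
    by (intro bexI[of _ "\<rho> \<inter> \<tau>"] conjI exI[of _ T] 1 2[symmetric] T(1) faces(2)
        face_in[OF \<rho>(1) faces(1)] cone_face_trans[OF faces(1) \<rho>(2)])
qed

lemma cong_rel_iff:
  "(p, q) \<in> cong_rel M pairing \<Sigma> \<longleftrightarrow> p \<in> points \<and> q \<in> points \<and> common_face p q"
proof -
  define r where "r = (\<lambda>p q. fst p \<in> \<Sigma> \<and> fst q \<in> \<Sigma> \<and> cone_face (fst p) (fst q) \<and>
    snd p \<in> topspace (U_cong M pairing (fst p)) \<and>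
    snd q = pullback_congruence (cone_monoid M pairing (fst q)) (snd p))"
  have cr: "(p, q) \<in> cong_rel M pairing \<Sigma> \<longleftrightarrow> p \<in> points \<and> q \<in> points \<and> equivclp r p q"
    unfolding cong_rel_def glue_rel_def r_def by simp
  have "common_face p q" if "equivclp r p q" and p: "p \<in> points"
    using that(1)
  proof (induction rule: equivclp_induct)
    case base
    have "fst p \<in> \<Sigma>" "chart_prime (fst p) (snd p)"
      using p by (auto simp: topspace_chart)
    then show ?case
      unfolding common_face_def using cone_face_self restrict_to_self by metis
  next
    case (step y z)
    obtain \<sigma> Q \<tau> R where yz: "y = (\<sigma>, Q)" "z = (\<tau>, R)"
      by (cases y; cases z)
    from step.hyps(2) show ?case
    proof
      assume "r y z"
      then show ?thesis
        using common_face_extend[of p \<sigma> Q \<tau>] step.IH yz by (simp add: r_def pullback_congruence_def)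
    next
      assume "r z y"
      then show ?thesis
        using common_face_restrict[of p \<sigma> R \<tau>] step.IH yz p
        by (auto simp: r_def pullback_congruence_def topspace_chart)
    qed
  qed
  moreover have "equivclp r p q" if cf: "common_face p q" and pq: "p \<in> points" "q \<in> points"
  proof -
    obtain \<rho> R where \<rho>: "\<rho> \<in> \<Sigma>" "cone_face \<rho> (fst p)" "cone_face \<rho> (fst q)" "chart_prime \<rho> R"
      "snd p = restrict_to (fst p) R" "snd q = restrict_to (fst q) R"
      using cf unfolding common_face_def by blast
    then have "r (\<rho>, R) p" "r (\<rho>, R) q"
      using pq by (auto simp: r_def topspace_chart pullback_congruence_def)
    then show ?thesis
      by (blast intro: equivclp_trans[OF equivclp_sym])
  qed
  ultimately show ?thesis
    unfolding cr by blast
qed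

lemma equiv_cong_rel: "equiv points (cong_rel M pairing \<Sigma>)"
  unfolding cong_rel_def by (rule equiv_glue_rel)

lemma glued_eq_iff:
  "p \<in> points \<Longrightarrow> q \<in> points \<Longrightarrow> glued p = glued q \<longleftrightarrow> common_face p q"
  by (subst eq_equiv_class_iff[OF equiv_cong_rel]) (simp_all only: cong_rel_iff simp_thms)

lemma point_iff: "(\<sigma>, Q) \<in> points \<longleftrightarrow> \<sigma> \<in> \<Sigma> \<and> chart_prime \<sigma> Q"
  by (simp add: topspace_chart)

lemma glued_restrict:
  assumes \<sigma>: "\<sigma> \<in> \<Sigma>" and \<tau>: "cone_face \<tau> \<sigma>" and R: "chart_prime \<tau> R"
  shows "glued (\<sigma>, restrict_to \<sigma> R) = glued (\<tau>, R)"
proof -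
  have \<tau>\<Sigma>: "\<tau> \<in> \<Sigma>"
    using \<sigma> \<tau> by (rule face_in)
  have "(\<sigma>, restrict_to \<sigma> R) \<in> points" "(\<tau>, R) \<in> points"
    using \<sigma> \<tau>\<Sigma> R chart_prime_restrict[OF \<sigma> \<tau> R] by (simp_all only: point_iff simp_thms)
  moreover have "common_face (\<sigma>, restrict_to \<sigma> R) (\<tau>, R)"
    unfolding common_face_def fst_conv snd_conv
    by (intro bexI[of _ \<tau>] conjI exI[of _ R] \<tau> \<tau>\<Sigma> R cone_face_self[OF \<tau>\<Sigma>] refl
        restrict_to_self[OF R, symmetric])
  ultimately show ?thesis
    by (simp only: glued_eq_iff)
qed

lemma topspace_X_cong: "topspace (X_cong M pairing \<Sigma>) = glued ` points"
  by (simp add: X_cong_def topspace_quotient_topology comp_def)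

text \<open>The charts are open in the glued space: in the chart of \<open>\<sigma>'\<close>, the points glued to \<open>V\<close>
  form a union over the common faces \<open>\<rho>\<close> of \<open>\<sigma>\<close> and \<open>\<sigma>'\<close>, and restriction from the
  chart of \<open>\<rho>\<close> is an open map.\<close>

lemma openin_chart_image:
  assumes \<sigma>: "\<sigma> \<in> \<Sigma>" and V: "openin (U_cong M pairing \<sigma>) V"
  shows "openin (X_cong M pairing \<Sigma>) (glued ` ({\<sigma>} \<times> V))"
proof -
  let ?X = "sum_topology (U_cong M pairing) \<Sigma>"
  obtain C where C: "congruence (chart_ring \<sigma>) C" and V_eq: "V = {P. chart_prime \<sigma> P \<and> \<not> C \<subseteq> P}"
    using V unfolding U_cong_def trop_algebra.openin_CSpec_T[OF trop_algebra_chart] by blast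
  have top: "topspace ?X = points"
    by (simp add: comp_def)
  have V_points: "{\<sigma>} \<times> V \<subseteq> points"
    using \<sigma> V_eq by (auto simp: topspace_chart)
  have "openin (U_cong M pairing \<sigma>') {Q'. (\<sigma>', Q') \<in> points \<and> glued (\<sigma>', Q') \<in> glued ` ({\<sigma>} \<times> V)}"
    if \<sigma>': "\<sigma>' \<in> \<Sigma>" for \<sigma>'
  proof -
    let ?F = "{\<rho> \<in> \<Sigma>. cone_face \<rho> \<sigma> \<and> cone_face \<rho> \<sigma>'}"
    let ?W = "\<lambda>\<rho>. {restrict_to \<sigma>' R | R. chart_prime \<rho> R \<and> \<not> C \<subseteq> R}"
    have CR: "C \<subseteq> restrict_to \<sigma> R \<longleftrightarrow> C \<subseteq> R" for R
      using congruence_subset[OF C] by blast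
    have "{Q'. (\<sigma>', Q') \<in> points \<and> glued (\<sigma>', Q') \<in> glued ` ({\<sigma>} \<times> V)} = (\<Union>\<rho>\<in>?F. ?W \<rho>)"
    proof (intro set_eqI iffI)
      fix Q' assume "Q' \<in> {Q'. (\<sigma>', Q') \<in> points \<and> glued (\<sigma>', Q') \<in> glued ` ({\<sigma>} \<times> V)}"
      then obtain Q where Q: "(\<sigma>', Q') \<in> points" "Q \<in> V" "glued (\<sigma>', Q') = glued (\<sigma>, Q)"
        by blast
      then have "common_face (\<sigma>', Q') (\<sigma>, Q)"
        using glued_eq_iff V_points by blast
      then obtain \<rho> R where \<rho>: "\<rho> \<in> ?F" and R: "chart_prime \<rho> R" "Q' = restrict_to \<sigma>' R"
        "Q = restrict_to \<sigma> R"
        unfolding common_face_def by auto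
      have "\<not> C \<subseteq> restrict_to \<sigma> R"
        using Q(2) unfolding V_eq R(3) by blast
      then have "\<not> C \<subseteq> R"
        unfolding CR .
      then show "Q' \<in> (\<Union>\<rho>\<in>?F. ?W \<rho>)"
        using \<rho> R by blast
    next
      fix Q' assume "Q' \<in> (\<Union>\<rho>\<in>?F. ?W \<rho>)"
      then obtain \<rho> R where \<rho>: "cone_face \<rho> \<sigma>" "cone_face \<rho> \<sigma>'" and R: "chart_prime \<rho> R"
        "\<not> C \<subseteq> R" "Q' = restrict_to \<sigma>' R"
        by blast
      have "glued (\<sigma>', Q') = glued (\<sigma>, restrict_to \<sigma> R)"
        unfolding R(3) glued_restrict[OF \<sigma>' \<rho>(2) R(1)] glued_restrict[OF \<sigma> \<rho>(1) R(1)] ..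
      moreover have "restrict_to \<sigma> R \<in> V"
        unfolding V_eq mem_Collect_eq CR using R(2) chart_prime_restrict[OF \<sigma> \<rho>(1) R(1)] by blast
      moreover have "(\<sigma>', Q') \<in> points"
        unfolding point_iff using \<sigma>' R(3) chart_prime_restrict[OF \<sigma>' \<rho>(2) R(1)] by simp
      ultimately show "Q' \<in> {Q'. (\<sigma>', Q') \<in> points \<and> glued (\<sigma>', Q') \<in> glued ` ({\<sigma>} \<times> V)}"
        by blast
    qed
    moreover have "openin (U_cong M pairing \<sigma>') (?W \<rho>)" if \<rho>: "\<rho> \<in> ?F" for \<rho>
    proof -
      obtain m where m: "cuts m \<sigma>' \<rho>"
        using face_cut[OF \<sigma>'] \<rho> by blast
      have "C \<subseteq> chart_ring \<rho> \<times> chart_ring \<rho>"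
        using congruence_subset[OF C] chart_ring_antimono[of \<rho> \<sigma>] \<rho> cone_face_subset by blast
      then show ?thesis
        unfolding U_cong_def
        by (rule trop_localization.openin_restrict_image[OF cuts_localization[OF cone[OF \<sigma>'] m]])
    qed
    ultimately show ?thesis
      by (simp only:) (intro openin_Union; blast)
  qed
  then have "openin ?X {p \<in> topspace ?X. glued p \<in> glued ` ({\<sigma>} \<times> V)}"
    unfolding openin_sum_topology top by (auto simp: comp_def)
  then show ?thesis
    unfolding X_cong_def openin_quotient_topology
    using V_points top by blast
qed

text \<open>The closure of a point consists, in each chart, of larger congruences: the chart is an
  open neighbourhood of each of its points, and so is the complement of the closed set of all
  congruences above \<open>Q\<close>.\<close>

lemma closure_of_point:
  assumes K: "\<sigma> \<in> \<Sigma>" "chart_prime \<sigma> K"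
    and cl: "glued (\<sigma>, K) \<in> X_cong M pairing \<Sigma> closure_of {P}"
  obtains Q where "chart_prime \<sigma> Q" "P = glued (\<sigma>, Q)" "Q \<subseteq> K"
proof -
  interpret A: trop_algebra const "chart_ring \<sigma>" by (rule trop_algebra_chart)
  have nbhd: "P \<in> glued ` ({\<sigma>} \<times> V)" if "openin (U_cong M pairing \<sigma>) V" "K \<in> V" for V
  proof -
    let ?W = "glued ` ({\<sigma>} \<times> V)"
    have "glued (\<sigma>, K) \<in> ?W"
      using that(2) by (intro imageI SigmaI singletonI)
    moreover have "openin (X_cong M pairing \<Sigma>) ?W"
      using openin_chart_image[OF K(1) that(1)] .
    ultimately have "\<exists>y. y \<in> {P} \<and> y \<in> ?W"
      using cl by (simp only: in_closure_of)
    then show ?thesis by simp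
  qed
  have "P \<in> glued ` ({\<sigma>} \<times> {Q. chart_prime \<sigma> Q})"
    using nbhd[OF openin_topspace, unfolded topspace_chart] K(2) by simp
  then obtain Q where "Q \<in> {Q. chart_prime \<sigma> Q}" "P = glued (\<sigma>, Q)"
    by (rule image_sliceE)
  then have Q: "chart_prime \<sigma> Q" "P = glued (\<sigma>, Q)"
    by simp_all
  have "Q \<subseteq> K"
  proof (rule ccontr)
    assume not: "\<not> Q \<subseteq> K"
    let ?V = "{P. chart_prime \<sigma> P \<and> \<not> Q \<subseteq> P}"
    have "openin (U_cong M pairing \<sigma>) ?V"
      unfolding U_cong_def
      by (intro A.openin_CSpec_T_not_subset congruence_subset[OF A.T_prime_congruence[OF Q(1)]])
    from nbhd[OF this] have "P \<in> glued ` ({\<sigma>} \<times> ?V)"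
      using K(2) not by simp
    then obtain Q' where "Q' \<in> ?V" and Q'_eq: "P = glued (\<sigma>, Q')"
      by (rule image_sliceE)
    then have Q': "chart_prime \<sigma> Q'" "\<not> Q \<subseteq> Q'"
      by simp_all
    have "(\<sigma>, Q) \<in> points" "(\<sigma>, Q') \<in> points" "glued (\<sigma>, Q) = glued (\<sigma>, Q')"
      using K(1) Q Q'(1) Q'_eq by (simp_all only: point_iff simp_thms)
    then have "common_face (\<sigma>, Q) (\<sigma>, Q')"
      by (simp only: glued_eq_iff)
    then have "Q = Q'"
      by (auto simp: common_face_def)
    with Q'(2) show False by simp
  qed
  with Q that show thesis by blast
qed

text \<open>The two congruences specialize one point of the chart of a common face, which then lies
  in the chart of \<open>\<sigma> \<inter> \<sigma>'\<close>. A functional separating \<open>\<sigma>\<close> from \<open>\<sigma>'\<close> along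
  \<open>\<sigma> \<inter> \<sigma>'\<close> shows that both congruences lie in this chart too; there, uniqueness is that of
  a geometric congruence above a prime.\<close>

lemma geometric_specialization_unique:
  assumes K: "\<sigma> \<in> \<Sigma>" "chart_prime \<sigma> K" "geometric const (chart_ring \<sigma>) K"
      "glued (\<sigma>, K) \<in> X_cong M pairing \<Sigma> closure_of {P}"
    and K': "\<sigma>' \<in> \<Sigma>" "chart_prime \<sigma>' K'" "geometric const (chart_ring \<sigma>') K'"
      "glued (\<sigma>', K') \<in> X_cong M pairing \<Sigma> closure_of {P}"
  shows "glued (\<sigma>, K) = glued (\<sigma>', K')"
proof -
  let ?\<tau> = "\<sigma> \<inter> \<sigma>'"
  obtain Q where Q: "chart_prime \<sigma> Q" "P = glued (\<sigma>, Q)" "Q \<subseteq> K"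
    using closure_of_point[OF K(1,2,4)] .
  obtain Q' where Q': "chart_prime \<sigma>' Q'" "P = glued (\<sigma>', Q')" "Q' \<subseteq> K'"
    using closure_of_point[OF K'(1,2,4)] .
  have "(\<sigma>, Q) \<in> points" "(\<sigma>', Q') \<in> points" "glued (\<sigma>, Q) = glued (\<sigma>', Q')"
    using K(1) K'(1) Q(1) Q'(1) Q(2)[symmetric] Q'(2) by (simp_all only: point_iff simp_thms)
  then have "common_face (\<sigma>, Q) (\<sigma>', Q')"
    by (simp only: glued_eq_iff)
  then obtain \<rho> R0 where \<rho>: "\<rho> \<in> \<Sigma>" "cone_face \<rho> \<sigma>" "cone_face \<rho> \<sigma>'" and R0: "chart_prime \<rho> R0"
    "Q = restrict_to \<sigma> R0" "Q' = restrict_to \<sigma>' R0"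
    by (auto simp: common_face_def)
  note faces = Int_face[OF K(1) K'(1)]
  have \<tau>: "?\<tau> \<in> \<Sigma>"
    using face_in[OF K(1) faces(1)] .
  have "cone_face \<rho> ?\<tau>"
    using \<rho> face_of_subset[of \<rho> \<sigma> ?\<tau>] cone_face_subset[OF \<rho>(2)] cone_face_subset[OF \<rho>(3)]
    by (simp add: cone_face_def)
  define R where "R = restrict_to ?\<tau> R0"
  have R: "chart_prime ?\<tau> R"
    unfolding R_def using \<tau> \<open>cone_face \<rho> ?\<tau>\<close> R0(1) by (rule chart_prime_restrict)
  have RK: "restrict_to \<sigma> R \<subseteq> K" "restrict_to \<sigma>' R \<subseteq> K'"
    using Q(3) Q'(3) unfolding R_def R0 by blast+
  obtain m where m: "m \<in> M" "\<And>v. v \<in> \<sigma> \<Longrightarrow> 0 \<le> pairing m v" "\<And>v. v \<in> \<sigma>' \<Longrightarrow> pairing m v \<le> 0"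
    "\<And>v. v \<in> \<sigma> \<Longrightarrow> pairing m v = 0 \<Longrightarrow> v \<in> \<sigma>'" "\<And>v. v \<in> \<sigma>' \<Longrightarrow> pairing m v = 0 \<Longrightarrow> v \<in> \<sigma>"
    using separation[OF cone[OF K(1)] _ cone[OF K'(1)]] faces unfolding cone_face_def by blast
  have "cuts m \<sigma> ?\<tau>" "cuts (- m) \<sigma>' ?\<tau>"
    unfolding cuts_def cone_monoid_iff linear_neg[OF linear_left]
    using m M_uminus by (auto intro: antisym)
  note loc = cuts_localization[OF cone[OF K(1)] this(1)]
    cuts_localization[OF cone[OF K'(1)] this(2), unfolded minus_minus]
  interpret L: trop_localization const "chart_ring \<sigma>" "chart_ring ?\<tau>" "monomial m" "monomial (- m)"
    by (rule loc(1))
  interpret L': trop_localization const "chart_ring \<sigma>'" "chart_ring ?\<tau>" "monomial (- m)" "monomial m"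
    by (rule loc(2))
  have nz: "(monomial m, 0) \<notin> K"
    by (rule opposite_localizations_not_zero[OF loc R K(2) RK(1) K'(2,3) RK(2)])
  have nz': "(monomial (- m), 0) \<notin> K'"
    by (rule opposite_localizations_not_zero[OF loc(2,1) R K'(2) RK(2) K(2,3) RK(1)])
  note E = L.extend_T_prime[OF K(2) nz] and E' = L'.extend_T_prime[OF K'(2) nz']
  note e = L.extend_restrict[OF K(2) nz] and e' = L'.extend_restrict[OF K'(2) nz']
  note cong = L.big.T_prime_congruence
  have sub: "R \<subseteq> L.extend K" "R \<subseteq> L'.extend K'"
    using L.restrict_subset_imp_subset[OF cong[OF R] cong[OF E]]
      L'.restrict_subset_imp_subset[OF cong[OF R] cong[OF E']] RK e e' by blast+
  have eq: "L.extend K = L'.extend K'"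
    using L.big.geometric_over_prime_unique[OF L.big.T_prime_prime[OF R] E
        L.extend_geometric[OF K(2,3) nz] sub(1) E' L'.extend_geometric[OF K'(2,3) nz'] sub(2)] .
  have "glued (\<sigma>, K) = glued (?\<tau>, L.extend K)"
    using glued_restrict[OF K(1) faces(1) E] unfolding e .
  also have "\<dots> = glued (\<sigma>', K')"
    using glued_restrict[OF K'(1) faces(2) E'] unfolding e' eq by simp
  finally show ?thesis .
qed

text \<open>The induced homomorphism fixes constants, so \<open>f\<close> is congruent to the constant that is its
  value.\<close>

lemma kernel_congruence_geometric:
  assumes "\<phi> \<in> U_trop M pairing \<sigma>"
  shows "geometric const (chart_ring \<sigma>) (kernel_congruence (cone_monoid M pairing \<sigma>) \<phi>)"
proof -
  interpret A: trop_algebra const "chart_ring \<sigma>" by (rule trop_algebra_chart)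
  have "\<phi> 0 = 1"
    using assms by (simp add: U_trop_def monoid_homs_def)
  then show ?thesis
    unfolding geometric_def kernel_congruence_def
    using A.c_in induced_hom_const[of \<phi>] by auto
qed

text \<open>In general \<open>trop_to_cong\<close> yields a union of gluing classes. A point of the glued space is a
  single class, hence the class of the kernel of any one representative.\<close>

lemma tropical_point_representative:
  assumes P\<^sub>0: "P\<^sub>0 \<in> trop_to_cong M pairing \<Sigma> ` X_trop M pairing \<Sigma>"
    and top: "P\<^sub>0 \<in> topspace (X_cong M pairing \<Sigma>)"
  obtains \<sigma> K where "\<sigma> \<in> \<Sigma>" "chart_prime \<sigma> K" "geometric const (chart_ring \<sigma>) K"
    "P\<^sub>0 = glued (\<sigma>, K)"
proof -
  obtain x where x: "x \<in> X_trop M pairing \<Sigma>" "P\<^sub>0 = trop_to_cong M pairing \<Sigma> x"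
    using P\<^sub>0 by blast
  obtain p where p: "p \<in> points" "P\<^sub>0 = glued p"
    using top unfolding topspace_X_cong by blast
  then have "p \<in> P\<^sub>0"
    using equiv_class_self[OF equiv_cong_rel] by blast
  then obtain \<sigma> \<phi> where \<sigma>: "(\<sigma>, \<phi>) \<in> x"
    and rel: "((\<sigma>, kernel_congruence (cone_monoid M pairing \<sigma>) \<phi>), p) \<in> cong_rel M pairing \<Sigma>"
    unfolding x(2) trop_to_cong_def by auto
  have "x \<subseteq> Sigma \<Sigma> (U_trop M pairing)"
    using x(1) in_quotient_imp_subset[OF equiv_glue_rel]
    unfolding X_trop_def trop_rel_def by blast
  then have "\<phi> \<in> U_trop M pairing \<sigma>"
    using \<sigma> by blast
  moreover have "(\<sigma>, kernel_congruence (cone_monoid M pairing \<sigma>) \<phi>) \<in> points"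
    using rel unfolding cong_rel_iff by blast
  moreover have "P\<^sub>0 = glued (\<sigma>, kernel_congruence (cone_monoid M pairing \<sigma>) \<phi>)"
    using p(2) equiv_class_eq[OF equiv_cong_rel rel] by simp
  ultimately show thesis
    using that kernel_congruence_geometric unfolding point_iff by blast
qed

end

theorem theorem6p12:
  fixes n :: nat
    and M :: "'m::real_vector set"
    and N :: "'n::real_vector set"
    and pairing :: "'m \<Rightarrow> 'n \<Rightarrow> real"
    and \<Sigma> :: "'n set set"
    and P :: "('n set \<times> (('m \<Rightarrow>\<^sub>0 trop) \<times> ('m \<Rightarrow>\<^sub>0 trop)) set) set"
  assumes "dual_lattices n M N pairing"
    and "fan N \<Sigma>"
    and "P \<in> topspace (X_cong M pairing \<Sigma>)"
  shows "\<exists>\<^sub>\<le>\<^sub>1 P\<^sub>0. P\<^sub>0 \<in> trop_to_cong M pairing \<Sigma> ` X_trop M pairing \<Sigma> \<and>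
    P\<^sub>0 \<in> X_cong M pairing \<Sigma> closure_of {P}"
proof -
  interpret toric_fan n M N pairing \<Sigma>
    using assms(1,2) by unfold_locales
  have top: "p \<in> topspace (X_cong M pairing \<Sigma>)" if "p \<in> X_cong M pairing \<Sigma> closure_of {P}" for p
    using that by (simp add: in_closure_of)
  show ?thesis
  proof (rule Uniq_I, elim conjE)
    fix p q
    assume p: "p \<in> trop_to_cong M pairing \<Sigma> ` X_trop M pairing \<Sigma>"
        "p \<in> X_cong M pairing \<Sigma> closure_of {P}"
      and q: "q \<in> trop_to_cong M pairing \<Sigma> ` X_trop M pairing \<Sigma>"
        "q \<in> X_cong M pairing \<Sigma> closure_of {P}"
    obtain \<sigma> K where K: "\<sigma> \<in> \<Sigma>" "chart_prime \<sigma> K" "geometric const (chart_ring \<sigma>) K"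
      and p_eq: "p = glued (\<sigma>, K)"
      using tropical_point_representative[OF p(1) top[OF p(2)]] .
    obtain \<sigma>' K' where K': "\<sigma>' \<in> \<Sigma>" "chart_prime \<sigma>' K'" "geometric const (chart_ring \<sigma>') K'"
      and q_eq: "q = glued (\<sigma>', K')"
      using tropical_point_representative[OF q(1) top[OF q(2)]] .
    show "p = q"
      using geometric_specialization_unique[OF K _ K'] p(2) q(2) unfolding p_eq q_eq by blast
  qed
qed

end
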